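(* Let $N\in\mathbb{N}$ and let $\Omega\subset\mathbb{R}^N$ be a bounded domain with connected Lipschitz boundary $\Gamma:=\partial\Omega$. For $P\in H(\operatorname{Curl};\Omega)$ put $$|||P|||:=\big(\|\operatorname{sym}P\|_{L^2(\Omega)}^2+\|\operatorname{Curl}P\|_{L^2(\Omega)}^2\big)^{1/2},\qquad \|P\|_{H(\operatorname{Curl};\Omega)}:=\big(\|P\|_{L^2(\Omega)}^2+\|\operatorname{Curl}P\|_{L^2(\Omega)}^2\big)^{1/2}.$$ Then on $\mathring{H}(\operatorname{Curl};\Omega)$ the norms $\|\cdot\|_{H(\operatorname{Curl};\Omega)}$ and $|||\cdot|||$ are equivalent. In particular, $|||\cdot|||$ is a norm on $\mathring{H}(\operatorname{Curl};\Omega)$ and there exists a constant $c>0$ such that $$c\,\|P\|_{H(\operatorname{Curl};\Omega)}^2\le|||P|||^2=\|\operatorname{sym}P\|_{L^2(\Omega)}^2+\|\operatorname{Curl}P\|_{L^2(\Omega)}^2$$ holds for all $P\in\mathring{H}(\operatorname{Curl};\Omega)$.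
   Context: All functions are real-valued and $L^2(\Omega)$ denotes $L^2(\Omega,\mathbb{R}^k)$ for the appropriate $k$, with the Euclidean (for matrices: Frobenius) norm on values. For a vector field $v:\Omega\to\mathbb{R}^N$, $\operatorname{curl}v$ is the $\mathbb{R}^{(N-1)N/2}$-valued field with entries $\partial_n v_m-\partial_m v_n$, $1\le n<m\le N$ (the exterior derivative of the $1$-form identified with $v$), understood in the weak (distributional) sense. Define $$H(\operatorname{curl};\Omega):=\{v\in L^2(\Omega,\mathbb{R}^N):\operatorname{curl}v\in L^2(\Omega,\mathbb{R}^{(N-1)N/2})\},$$ and let $\mathring{H}(\operatorname{curl};\Omega)$ be the closure of the compactly supported smooth vector fields $C_c^\infty(\Omega,\mathbb{R}^N)$ in $H(\operatorname{curl};\Omega)$ with respect to the graph norm $(\|v\|_{L^2(\Omega)}^2+\|\operatorname{curl}v\|_{L^2(\Omega)}^2)^{1/2}$; this generalizes the homogeneous tangential boundary condition on $\Gamma$. For a tensor field $P:\Omega\to\mathbb{R}^{N\times N}$ with rows $P_1,\dots,P_N$, $\operatorname{Curl}P$ is the $N\times(N-1)N/2$ tensor field whose $n$-th row is $\operatorname{curl}P_n$. $H(\operatorname{Curl};\Omega)$ (resp. $\mathring{H}(\operatorname{Curl};\Omega)$) is the space of tensor fields all of whose rows belong to $H(\operatorname{curl};\Omega)$ (resp. $\mathring{H}(\operatorname{curl};\Omega)$). Finally $\operatorname{sym}P:=\frac12(P+P^T)$. *)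

theory Defs
  imports "HOL-Analysis.Analysis"
begin

(* Plain vec instead of the caret notation, which would insert the sort finite at every occurrence
   of 'n and so clash with the sort {finite,linorder} below. *)
type_synonym 'n rvec = "(real, 'n) vec"
type_synonym 'n rmat = "((real, 'n) vec, 'n) vec"

fun times_differentiable :: "nat \<Rightarrow> ('a::real_normed_vector \<Rightarrow> 'b::real_normed_vector) \<Rightarrow> bool" where
  "times_differentiable 0 f \<longleftrightarrow> continuous_on UNIV f"
| "times_differentiable (Suc k) f \<longleftrightarrow>
     (\<forall>x. f differentiable (at x)) \<and>
     (\<forall>h. times_differentiable k (\<lambda>x. frechet_derivative f (at x) h))"

(* Elements of C_c^infinity(Omega) are regarded as extended by zero to the whole space. *)
definition test_functions ::
    "'a::real_normed_vector set \<Rightarrow> ('a \<Rightarrow> 'b::real_normed_vector) set" where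
  "test_functions \<Omega> =
     {\<phi>. (\<forall>k. times_differentiable k \<phi>) \<and>
         compact (closure {x. \<phi> x \<noteq> 0}) \<and> closure {x. \<phi> x \<noteq> 0} \<subseteq> \<Omega>}"

(* Square integrable representatives: functions are total, only their values on Omega matter,
   and functions agreeing almost everywhere on Omega are not identified as HOL objects. *)
definition L2 :: "'a::euclidean_space set \<Rightarrow> ('a \<Rightarrow> 'b::real_normed_vector) set" where
  "L2 \<Omega> = {f. f \<in> borel_measurable (lebesgue_on \<Omega>) \<and>
             integrable (lebesgue_on \<Omega>) (\<lambda>x. (norm (f x))\<^sup>2)}"

definition L2_norm :: "'a::euclidean_space set \<Rightarrow> ('a \<Rightarrow> 'b::real_normed_vector) \<Rightarrow> real" where
  "L2_norm \<Omega> f = sqrt (\<integral>x. (norm (f x))\<^sup>2 \<partial>lebesgue_on \<Omega>)"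

(* The N(N-1)/2 entries of a curl are stored as the strictly upper triangular part of an N x N
   matrix that vanishes elsewhere; the norm of real^'n^'n (Frobenius) is then the Euclidean norm
   of these entries. *)
definition has_weak_curl ::
    "('n::{finite,linorder}) rvec set \<Rightarrow> ('n rvec \<Rightarrow> 'n rvec) \<Rightarrow> ('n rvec \<Rightarrow> 'n rmat) \<Rightarrow> bool" where
  "has_weak_curl \<Omega> v w \<longleftrightarrow>
     (\<forall>n m. n < m \<longrightarrow> (\<forall>\<phi>\<in>test_functions \<Omega>.
        (\<integral>x. w x $ n $ m * \<phi> x \<partial>lebesgue_on \<Omega>) =
        - (\<integral>x. v x $ m * frechet_derivative \<phi> (at x) (axis n 1)
              - v x $ n * frechet_derivative \<phi> (at x) (axis m 1) \<partial>lebesgue_on \<Omega>))) \<and>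
     (\<forall>n m. \<not> n < m \<longrightarrow> (\<forall>x\<in>\<Omega>. w x $ n $ m = 0))"

definition H_curl :: "('n::{finite,linorder}) rvec set \<Rightarrow> ('n rvec \<Rightarrow> 'n rvec) set" where
  "H_curl \<Omega> = {v \<in> L2 \<Omega>. \<exists>w\<in>L2 \<Omega>. has_weak_curl \<Omega> v w}"

(* Meaningful for v in H_curl Omega, and then unique up to null sets of Omega. *)
definition curl ::
    "('n::{finite,linorder}) rvec set \<Rightarrow> ('n rvec \<Rightarrow> 'n rvec) \<Rightarrow> 'n rvec \<Rightarrow> 'n rmat" where
  "curl \<Omega> v = (SOME w. w \<in> L2 \<Omega> \<and> has_weak_curl \<Omega> v w)"

definition H_curl_norm :: "('n::{finite,linorder}) rvec set \<Rightarrow> ('n rvec \<Rightarrow> 'n rvec) \<Rightarrow> real" where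
  "H_curl_norm \<Omega> v = sqrt ((L2_norm \<Omega> v)\<^sup>2 + (L2_norm \<Omega> (curl \<Omega> v))\<^sup>2)"

definition H0_curl :: "('n::{finite,linorder}) rvec set \<Rightarrow> ('n rvec \<Rightarrow> 'n rvec) set" where
  "H0_curl \<Omega> = {v \<in> H_curl \<Omega>. \<forall>\<epsilon>>0. \<exists>\<phi>\<in>test_functions \<Omega>. H_curl_norm \<Omega> (\<lambda>x. v x - \<phi> x) < \<epsilon>}"

definition Curl ::
    "('n::{finite,linorder}) rvec set \<Rightarrow> ('n rvec \<Rightarrow> 'n rmat) \<Rightarrow> 'n rvec \<Rightarrow> ('n rmat, 'n) vec" where
  "Curl \<Omega> P = (\<lambda>x. \<chi> n. curl \<Omega> (\<lambda>y. row n (P y)) x)"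

definition H_Curl :: "('n::{finite,linorder}) rvec set \<Rightarrow> ('n rvec \<Rightarrow> 'n rmat) set" where
  "H_Curl \<Omega> = {P. \<forall>n. (\<lambda>x. row n (P x)) \<in> H_curl \<Omega>}"

definition H0_Curl :: "('n::{finite,linorder}) rvec set \<Rightarrow> ('n rvec \<Rightarrow> 'n rmat) set" where
  "H0_Curl \<Omega> = {P. \<forall>n. (\<lambda>x. row n (P x)) \<in> H0_curl \<Omega>}"

definition sym_part :: "real^'n^'n \<Rightarrow> real^'n^'n" where
  "sym_part A = (1/2) *\<^sub>R (A + transpose A)"

definition H_Curl_norm :: "('n::{finite,linorder}) rvec set \<Rightarrow> ('n rvec \<Rightarrow> 'n rmat) \<Rightarrow> real" where
  "H_Curl_norm \<Omega> P = sqrt ((L2_norm \<Omega> P)\<^sup>2 + (L2_norm \<Omega> (Curl \<Omega> P))\<^sup>2)"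

definition sym_Curl_norm :: "('n::{finite,linorder}) rvec set \<Rightarrow> ('n rvec \<Rightarrow> 'n rmat) \<Rightarrow> real" where
  "sym_Curl_norm \<Omega> P =
     sqrt ((L2_norm \<Omega> (\<lambda>x. sym_part (P x)))\<^sup>2 + (L2_norm \<Omega> (Curl \<Omega> P))\<^sup>2)"

(* V is a linear space of functions and p induces a norm on V modulo equality almost everywhere.
   That p respects this identification follows from definiteness and the triangle inequality. *)
definition norm_modulo_AE ::
    "'a measure \<Rightarrow> ('a \<Rightarrow> 'b::real_vector) set \<Rightarrow> (('a \<Rightarrow> 'b) \<Rightarrow> real) \<Rightarrow> bool" where
  "norm_modulo_AE M V p \<longleftrightarrow>
     (\<lambda>x. 0) \<in> V \<and>
     (\<forall>f\<in>V. \<forall>g\<in>V. (\<lambda>x. f x + g x) \<in> V) \<and>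
     (\<forall>c. \<forall>f\<in>V. (\<lambda>x. c *\<^sub>R f x) \<in> V) \<and>
     (\<forall>f\<in>V. 0 \<le> p f) \<and>
     (\<forall>f\<in>V. p f = 0 \<longleftrightarrow> (AE x in M. f x = 0)) \<and>
     (\<forall>c. \<forall>f\<in>V. p (\<lambda>x. c *\<^sub>R f x) = \<bar>c\<bar> * p f) \<and>
     (\<forall>f\<in>V. \<forall>g\<in>V. p (\<lambda>x. f x + g x) \<le> p f + p g)"

definition equivalent_on :: "'a set \<Rightarrow> ('a \<Rightarrow> real) \<Rightarrow> ('a \<Rightarrow> real) \<Rightarrow> bool" where
  "equivalent_on V p q \<longleftrightarrow> (\<exists>a>0. \<exists>b>0. \<forall>f\<in>V. a * p f \<le> q f \<and> q f \<le> b * p f)"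

(* Near each boundary point, in suitable orthonormal coordinates with last axis e, the boundary
   is the graph of a Lipschitz function g on the hyperplane orthogonal to e, and the set lies on
   one side of it. *)
definition lipschitz_boundary :: "'a::euclidean_space set \<Rightarrow> bool" where
  "lipschitz_boundary \<Omega> \<longleftrightarrow>
     (\<forall>p\<in>frontier \<Omega>. \<exists>U e g L.
        open U \<and> p \<in> U \<and> norm e = 1 \<and> L-lipschitz_on {y. y \<bullet> e = 0} g \<and>
        \<Omega> \<inter> U = {x\<in>U. g (x - (x \<bullet> e) *\<^sub>R e) < x \<bullet> e} \<and>
        frontier \<Omega> \<inter> U = {x\<in>U. x \<bullet> e = g (x - (x \<bullet> e) *\<^sub>R e)})"

end

theory Submission
  imports Defs
begin

text \<open>
Why the inequality holds.  Since \<^term>\<open>H0_Curl \<Omega>\<close> is a closure of test fields, it suffices to bound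
\<open>\<parallel>\<Phi>\<parallel>\<close> by \<open>\<parallel>sym \<Phi>\<parallel> + \<parallel>Curl \<Phi>\<parallel>\<close> for a smooth matrix field \<open>\<Phi>\<close> with compact support in \<open>\<Omega>\<close>, with a
constant that depends only on the dimension and on the size of \<open>\<Omega>\<close>.  For gradients this is
Korn's first inequality \<open>\<parallel>\<nabla>u\<parallel>\<^sup>2 \<le> 2 \<parallel>sym \<nabla>u\<parallel>\<^sup>2\<close>, valid for compactly supported \<open>u\<close> because the
cross terms integrate to \<open>\<integral>(div u)\<^sup>2 \<ge> 0\<close>.  A general \<open>\<Phi>\<close> is a gradient up to an error
controlled by its Curl, and the point is to choose the potential so that it keeps compact support.

Fix a coordinate direction \<open>e\<close> and a length \<open>L\<close> larger than the diameter of \<open>\<Omega>\<close>, and integrate the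
\<open>e\<close>-column of \<open>\<Phi>\<close> over segments of length \<open>L\<close>: \<open>u\<^sub>n(x) = \<integral>\<^sub>0\<^sup>L \<Phi>\<^sub>n\<^sub>e(x - t e) dt\<close>.  Writing
\<open>\<partial>\<^sub>m \<Phi>\<^sub>n\<^sub>e = \<partial>\<^sub>e \<Phi>\<^sub>n\<^sub>m + c\<^sub>n\<^sub>m\<close>, where \<open>c\<^sub>n\<^sub>m\<close> is an entry of the curl of the \<open>n\<close>-th row up to sign, the
fundamental theorem of calculus gives
\<open>\<nabla>u(x) = \<Phi>(x) - \<Phi>(x - L e) + Q(x)\<close> with \<open>Q\<^sub>n\<^sub>m(x) = \<integral>\<^sub>0\<^sup>L c\<^sub>n\<^sub>m(x - t e) dt\<close>.
All terms have compact support, \<open>\<parallel>Q\<parallel>\<close> is at most a multiple of \<open>\<parallel>Curl \<Phi>\<parallel>\<close>, and since \<open>\<Phi>\<close> and its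
translate have disjoint supports, \<open>\<parallel>\<Phi>\<parallel> \<le> \<parallel>\<Phi> - \<Phi>(\<cdot> - L e)\<parallel>\<close>, so subtracting the translate loses
nothing.  Applying Korn's inequality to \<open>u\<close> yields the estimate (\<open>Korn_Curl_test_fields\<close>).

Norm axioms for the graph norms require that the weak curl is additive up to null sets, that is,
unique.  This is the fundamental lemma of the calculus of variations, which is proved with smooth
bumps that converge to indicator functions of boxes.  Uniqueness also identifies the weak curl of a
test field with its classical curl, so that the estimate passes to the closure
(\<open>Korn_Curl_inequality\<close>).
\<close>

section \<open>Square integrable functions\<close>
lemma L2_memI:
  fixes f :: "'a::euclidean_space \<Rightarrow> 'b::euclidean_space"
  assumes "f \<in> borel_measurable (lebesgue_on \<Omega>)"
    and "integrable (lebesgue_on \<Omega>) h" and "\<And>x. x \<in> \<Omega> \<Longrightarrow> (norm (f x))\<^sup>2 \<le> h x"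
  shows "f \<in> L2 \<Omega>"
proof -
  have "integrable (lebesgue_on \<Omega>) (\<lambda>x. (norm (f x))\<^sup>2)"
  proof (rule Bochner_Integration.integrable_bound[OF assms(2)])
    show "(\<lambda>x. (norm (f x))\<^sup>2) \<in> borel_measurable (lebesgue_on \<Omega>)"
      using assms(1) by measurable
    show "AE x in lebesgue_on \<Omega>. norm ((norm (f x))\<^sup>2) \<le> norm (h x)"
      using assms(3) by (intro AE_I2) fastforce
  qed
  with assms(1) show ?thesis by (simp add: L2_def)
qed

lemma L2_measurable: "f \<in> L2 \<Omega> \<Longrightarrow> f \<in> borel_measurable (lebesgue_on \<Omega>)"
  by (simp add: L2_def)

lemma L2_integrable: "f \<in> L2 \<Omega> \<Longrightarrow> integrable (lebesgue_on \<Omega>) (\<lambda>x. (norm (f x))\<^sup>2)"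
  by (simp add: L2_def)

lemma L2_norm_nonneg: "0 \<le> L2_norm \<Omega> f"
  by (simp add: L2_norm_def)

lemma L2_norm_power2: "(L2_norm \<Omega> f)\<^sup>2 = (\<integral>x. (norm (f x))\<^sup>2 \<partial>lebesgue_on \<Omega>)"
  by (simp add: L2_norm_def)

lemma L2_add:
  fixes f g :: "'a::euclidean_space \<Rightarrow> 'b::euclidean_space"
  assumes "f \<in> L2 \<Omega>" "g \<in> L2 \<Omega>"
  shows "(\<lambda>x. f x + g x) \<in> L2 \<Omega>"
proof (rule L2_memI)
  show "(\<lambda>x. f x + g x) \<in> borel_measurable (lebesgue_on \<Omega>)"
    using assms[THEN L2_measurable] by measurable
  show "integrable (lebesgue_on \<Omega>) (\<lambda>x. 2 * (norm (f x))\<^sup>2 + 2 * (norm (g x))\<^sup>2)"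
    using assms[THEN L2_integrable] by auto
  fix x
  have "(norm (f x + g x))\<^sup>2 \<le> (norm (f x) + norm (g x))\<^sup>2"
    by (simp add: norm_triangle_ineq power_mono)
  also have "\<dots> \<le> 2 * (norm (f x))\<^sup>2 + 2 * (norm (g x))\<^sup>2"
    using sum_squares_bound[of "norm (f x)" "norm (g x)"] by (simp add: power2_sum)
  finally show "(norm (f x + g x))\<^sup>2 \<le> \<dots>" .
qed

lemma L2_linear_image:
  fixes f :: "'a::euclidean_space \<Rightarrow> 'b::euclidean_space" and T :: "'b \<Rightarrow> 'c::euclidean_space"
  assumes f: "f \<in> L2 \<Omega>" and T: "linear T"
  shows "(\<lambda>x. T (f x)) \<in> L2 \<Omega>"
proof -
  obtain K where K: "\<And>v. norm (T v) \<le> norm v * K"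
    using T bounded_linear.bounded linear_conv_bounded_linear by blast
  show ?thesis
  proof (rule L2_memI)
    have "T \<in> borel_measurable borel"
      using T by (intro borel_measurable_continuous_onI linear_continuous_on)
        (simp add: linear_conv_bounded_linear)
    with L2_measurable[OF f] show "(\<lambda>x. T (f x)) \<in> borel_measurable (lebesgue_on \<Omega>)"
      by measurable
    show "integrable (lebesgue_on \<Omega>) (\<lambda>x. K\<^sup>2 * (norm (f x))\<^sup>2)"
      using L2_integrable[OF f] by auto
    show "(norm (T (f x)))\<^sup>2 \<le> K\<^sup>2 * (norm (f x))\<^sup>2" for x
      using power_mono[OF K[of "f x"], of 2] by (simp add: power_mult_distrib mult.commute)
  qed
qed

lemma L2_scaleR: "f \<in> L2 \<Omega> \<Longrightarrow> (\<lambda>x. c *\<^sub>R f x) \<in> L2 \<Omega>"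
  for f :: "'a::euclidean_space \<Rightarrow> 'b::euclidean_space"
  by (rule L2_linear_image) (auto intro: linear_scaleR)

lemma L2_zero: "(\<lambda>x. 0) \<in> L2 \<Omega>"
  by (simp add: L2_def)

lemma linear_vec_nth: "linear (\<lambda>v::'b::real_vector^'i::finite. v $ i)"
  by (auto intro: linearI)

lemma L2_vec:
  fixes f :: "'a::euclidean_space \<Rightarrow> ('b::euclidean_space)^'i::finite"
  assumes "\<And>i. (\<lambda>x. f x $ i) \<in> L2 \<Omega>"
  shows "f \<in> L2 \<Omega>"
proof (rule L2_memI)
  have "(\<lambda>x. \<Sum>i\<in>UNIV. axis i (f x $ i)) \<in> borel_measurable (lebesgue_on \<Omega>)"
  proof (rule borel_measurable_sum)
    fix i
    have "(\<lambda>v::'b. axis i v :: 'b^'i) \<in> borel_measurable borel"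
      by (intro borel_measurable_continuous_onI linear_continuous_on)
        (auto simp: linear_conv_bounded_linear[symmetric] axis_def vec_eq_iff intro!: linearI)
    with L2_measurable[OF assms, of i]
    show "(\<lambda>x. axis i (f x $ i)) \<in> borel_measurable (lebesgue_on \<Omega>)"
      by measurable
  qed
  moreover have "(\<Sum>i\<in>UNIV. axis i (v $ i)) = v" for v :: "'b^'i"
    by (simp add: vec_eq_iff axis_def)
  ultimately show "f \<in> borel_measurable (lebesgue_on \<Omega>)" by simp
  show "integrable (lebesgue_on \<Omega>) (\<lambda>x. \<Sum>i\<in>UNIV. (norm (f x $ i))\<^sup>2)"
    by (intro Bochner_Integration.integrable_sum L2_integrable assms)
  show "(norm (f x))\<^sup>2 \<le> (\<Sum>i\<in>UNIV. (norm (f x $ i))\<^sup>2)" for x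
    by (simp add: norm_vec_def L2_set_def sum_nonneg)
qed

lemma L2_norm_vec:
  fixes f :: "'a::euclidean_space \<Rightarrow> ('b::euclidean_space)^'i::finite"
  assumes "f \<in> L2 \<Omega>"
  shows "(L2_norm \<Omega> f)\<^sup>2 = (\<Sum>i\<in>UNIV. (L2_norm \<Omega> (\<lambda>x. f x $ i))\<^sup>2)"
proof -
  have "(\<lambda>x. f x $ i) \<in> L2 \<Omega>" for i
    by (rule L2_linear_image[OF assms linear_vec_nth])
  then show ?thesis
    unfolding L2_norm_power2
    by (subst Bochner_Integration.integral_sum[symmetric])
      (auto simp: norm_vec_def L2_set_def sum_nonneg intro: L2_integrable)
qed

lemma L2_norm_cong_AE:
  assumes "f \<in> L2 \<Omega>" "g \<in> L2 \<Omega>" "AE x in lebesgue_on \<Omega>. f x = g x"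
  shows "L2_norm \<Omega> f = L2_norm \<Omega> g"
  unfolding L2_norm_def using assms(1,2)[THEN L2_integrable] assms(3)
  by (intro arg_cong[of _ _ sqrt] integral_cong_AE) auto

lemma L2_norm_eq_0_iff:
  assumes "f \<in> L2 \<Omega>"
  shows "L2_norm \<Omega> f = 0 \<longleftrightarrow> (AE x in lebesgue_on \<Omega>. f x = 0)"
  using integral_nonneg_eq_0_iff_AE[OF L2_integrable[OF assms]]
  by (simp add: L2_norm_def)

lemma L2_norm_scaleR: "L2_norm \<Omega> (\<lambda>x. c *\<^sub>R f x) = \<bar>c\<bar> * L2_norm \<Omega> f"
  by (simp add: L2_norm_def power_mult_distrib real_sqrt_mult)

lemma L2_mult_integrable:
  fixes f :: "'a::euclidean_space \<Rightarrow> 'b::euclidean_space" and g :: "'a \<Rightarrow> 'c::euclidean_space"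
  assumes "f \<in> L2 \<Omega>" "g \<in> L2 \<Omega>"
  shows "integrable (lebesgue_on \<Omega>) (\<lambda>x. norm (f x) * norm (g x))"
proof (rule Bochner_Integration.integrable_bound)
  show "integrable (lebesgue_on \<Omega>) (\<lambda>x. (norm (f x))\<^sup>2 + (norm (g x))\<^sup>2)"
    using assms[THEN L2_integrable] by auto
  show "(\<lambda>x. norm (f x) * norm (g x)) \<in> borel_measurable (lebesgue_on \<Omega>)"
    using assms[THEN L2_measurable] by measurable
  have "norm (f x) * norm (g x) \<le> (norm (f x))\<^sup>2 + (norm (g x))\<^sup>2" for x
  proof -
    have "0 \<le> norm (f x) * norm (g x)" by simp
    with sum_squares_bound[of "norm (f x)" "norm (g x)"] show ?thesis by linarith
  qed
  then show "AE x in lebesgue_on \<Omega>. norm (norm (f x) * norm (g x))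
      \<le> norm ((norm (f x))\<^sup>2 + (norm (g x))\<^sup>2)"
    by (intro AE_I2) simp
qed

text \<open>The integral of \<open>(|f| - t |g|)\<^sup>2\<close> is a nonnegative quadratic polynomial in \<open>t\<close>.\<close>
lemma L2_Cauchy_Schwarz:
  fixes f :: "'a::euclidean_space \<Rightarrow> 'b::euclidean_space" and g :: "'a \<Rightarrow> 'c::euclidean_space"
  assumes f: "f \<in> L2 \<Omega>" and g: "g \<in> L2 \<Omega>"
  shows "(\<integral>x. norm (f x) * norm (g x) \<partial>lebesgue_on \<Omega>) \<le> L2_norm \<Omega> f * L2_norm \<Omega> g"
proof -
  define A B C where "A = (L2_norm \<Omega> f)\<^sup>2" and "B = (L2_norm \<Omega> g)\<^sup>2"
    and "C = (\<integral>x. norm (f x) * norm (g x) \<partial>lebesgue_on \<Omega>)"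
  note ints = L2_integrable[OF f] L2_integrable[OF g] L2_mult_integrable[OF f g]
  have quad: "2 * t * C \<le> A + t\<^sup>2 * B" for t
  proof -
    have "0 \<le> (\<integral>x. (norm (f x) - t * norm (g x))\<^sup>2 \<partial>lebesgue_on \<Omega>)"
      by simp
    also have "\<dots> = (\<integral>x. (norm (f x))\<^sup>2 - 2 * t * (norm (f x) * norm (g x))
        + t\<^sup>2 * (norm (g x))\<^sup>2 \<partial>lebesgue_on \<Omega>)"
      by (intro Bochner_Integration.integral_cong) (auto simp: power2_eq_square algebra_simps)
    also have "\<dots> = A - 2 * t * C + t\<^sup>2 * B"
      unfolding A_def B_def C_def L2_norm_power2 using ints by simp
    finally show ?thesis by simp
  qed
  have "C\<^sup>2 \<le> A * B"
  proof (cases "B = 0")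
    case True
    then have "AE x in lebesgue_on \<Omega>. g x = 0"
      using L2_norm_eq_0_iff[OF g] by (simp add: B_def)
    then have "C = (\<integral>x. 0 \<partial>lebesgue_on \<Omega>)"
      unfolding C_def using ints(3) by (intro integral_cong_AE) auto
    then show ?thesis using True by simp
  next
    case False
    then have "B > 0" by (simp add: B_def)
    \<comment> \<open>\<open>C / B\<close> minimises the quadratic polynomial.\<close>
    with quad[of "C / B"] show ?thesis by (simp add: power2_eq_square field_simps)
  qed
  then have "C\<^sup>2 \<le> (L2_norm \<Omega> f * L2_norm \<Omega> g)\<^sup>2"
    by (simp add: A_def B_def power_mult_distrib)
  then show ?thesis
    unfolding C_def[symmetric] by (rule power2_le_imp_le) (simp add: L2_norm_nonneg)
qed

lemma L2_norm_triangle: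
  fixes f g :: "'a::euclidean_space \<Rightarrow> 'b::euclidean_space"
  assumes f: "f \<in> L2 \<Omega>" and g: "g \<in> L2 \<Omega>"
  shows "L2_norm \<Omega> (\<lambda>x. f x + g x) \<le> L2_norm \<Omega> f + L2_norm \<Omega> g"
proof (rule power2_le_imp_le)
  note ints = L2_integrable[OF f] L2_integrable[OF g] L2_mult_integrable[OF f g]
  have "(L2_norm \<Omega> (\<lambda>x. f x + g x))\<^sup>2
      \<le> (\<integral>x. (norm (f x))\<^sup>2 + 2 * (norm (f x) * norm (g x)) + (norm (g x))\<^sup>2 \<partial>lebesgue_on \<Omega>)"
    unfolding L2_norm_power2
  proof (rule integral_mono)
    fix x
    have "(norm (f x + g x))\<^sup>2 \<le> (norm (f x) + norm (g x))\<^sup>2"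
      by (simp add: norm_triangle_ineq power_mono)
    then show "(norm (f x + g x))\<^sup>2
        \<le> (norm (f x))\<^sup>2 + 2 * (norm (f x) * norm (g x)) + (norm (g x))\<^sup>2"
      by (simp add: power2_sum algebra_simps)
  qed (use ints L2_integrable[OF L2_add[OF f g]] in auto)
  also have "\<dots> = (L2_norm \<Omega> f)\<^sup>2 + 2 * (\<integral>x. norm (f x) * norm (g x) \<partial>lebesgue_on \<Omega>)
      + (L2_norm \<Omega> g)\<^sup>2"
    unfolding L2_norm_power2 using ints by simp
  also have "\<dots> \<le> (L2_norm \<Omega> f + L2_norm \<Omega> g)\<^sup>2"
    using L2_Cauchy_Schwarz[OF f g] by (simp add: power2_sum)
  finally show "(L2_norm \<Omega> (\<lambda>x. f x + g x))\<^sup>2 \<le> (L2_norm \<Omega> f + L2_norm \<Omega> g)\<^sup>2" .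
qed (simp add: L2_norm_nonneg)

lemma L2_norm_mono:
  assumes "f \<in> L2 \<Omega>" "g \<in> L2 \<Omega>" "0 \<le> K" "\<And>x. x \<in> \<Omega> \<Longrightarrow> norm (f x) \<le> K * norm (g x)"
  shows "L2_norm \<Omega> f \<le> K * L2_norm \<Omega> g"
proof (rule power2_le_imp_le)
  have "(L2_norm \<Omega> f)\<^sup>2 \<le> (\<integral>x. K\<^sup>2 * (norm (g x))\<^sup>2 \<partial>lebesgue_on \<Omega>)"
    unfolding L2_norm_power2
    using assms(1,2)[THEN L2_integrable] power_mono[OF assms(4), of _ 2]
    by (intro integral_mono) (auto simp: power_mult_distrib)
  then show "(L2_norm \<Omega> f)\<^sup>2 \<le> (K * L2_norm \<Omega> g)\<^sup>2"
    by (simp add: power_mult_distrib L2_norm_power2)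
qed (use assms(3) in \<open>simp add: L2_norm_nonneg\<close>)

section \<open>Calculus of smooth functions\<close>
lemma frechet_derivative_eqI: "(f has_derivative D) (at x) \<Longrightarrow> frechet_derivative f (at x) = D"
  using frechet_derivative_at by metis

text \<open>Replaces the Frechet derivative chosen by the definition with one that is computed by the
derivative rules.\<close>
lemma times_differentiable_SucI:
  assumes "\<And>x. (f has_derivative D x) (at x)" and "\<And>h. times_differentiable k (\<lambda>x. D x h)"
  shows "times_differentiable (Suc k) f"
proof -
  have "frechet_derivative f (at x) = D x" for x
    using assms(1) by (rule frechet_derivative_eqI)
  then show ?thesis
    using assms differentiableI by (auto intro: differentiableI)
qed

lemma times_differentiable_SucD:
  assumes "times_differentiable (Suc k) f"
  shows "(f has_derivative frechet_derivative f (at x)) (at x)"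
    and "times_differentiable k (\<lambda>x. frechet_derivative f (at x) h)"
  using assms by (auto simp: frechet_derivative_works)

lemma times_differentiable_less_order: "times_differentiable (Suc k) f \<Longrightarrow> times_differentiable k f"
proof (induction k arbitrary: f)
  case 0
  then show ?case
    by (auto simp: continuous_on_eq_continuous_at differentiable_imp_continuous_within)
next
  case (Suc k)
  then show ?case by auto
qed

lemma times_differentiable_const: "times_differentiable k (\<lambda>x. c)"
proof (induction k arbitrary: c)
  case (Suc k)
  show ?case by (rule times_differentiable_SucI[of _ "\<lambda>x h. 0"]) (auto intro: Suc)
qed auto

lemma times_differentiable_add:
  "times_differentiable k f \<Longrightarrow> times_differentiable k g \<Longrightarrow> times_differentiable k (\<lambda>x. f x + g x)"
proof (induction k arbitrary: f g)
  case 0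
  then show ?case by (auto intro: continuous_intros)
next
  case (Suc k)
  note f = times_differentiable_SucD[OF Suc.prems(1)]
  note g = times_differentiable_SucD[OF Suc.prems(2)]
  show ?case
    by (rule times_differentiable_SucI, rule has_derivative_add[OF f(1) g(1)]) (intro Suc.IH f g)
qed

lemma times_differentiable_linear_comp:
  assumes T: "bounded_linear T"
  shows "times_differentiable k f \<Longrightarrow> times_differentiable k (\<lambda>x. T (f x))"
proof (induction k arbitrary: f)
  case 0
  then show ?case
    by (auto intro: bounded_linear.continuous_on[OF T])
next
  case (Suc k)
  note f = times_differentiable_SucD[OF Suc.prems]
  show ?case
    by (rule times_differentiable_SucI, rule bounded_linear.has_derivative[OF T f(1)]) (intro Suc.IH f)
qed

lemma times_differentiable_comp_affine:
  assumes T: "bounded_linear T"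
  shows "times_differentiable k f \<Longrightarrow> times_differentiable k (\<lambda>x. f (T x + c))"
proof (induction k arbitrary: f)
  case 0
  have "continuous_on UNIV (\<lambda>x. T x + c)"
    by (intro continuous_intros linear_continuous_on T)
  with 0 show ?case
    by (auto intro: continuous_on_compose2[of UNIV f])
next
  case (Suc k)
  note f = times_differentiable_SucD[OF Suc.prems]
  have "((\<lambda>x. T x + c) has_derivative T) (at x)" for x
    using has_derivative_add_const[OF bounded_linear_imp_has_derivative[OF T]] .
  then have "((\<lambda>x. f (T x + c)) has_derivative
      (\<lambda>h. frechet_derivative f (at (T x + c)) (T h))) (at x)" for x
    by (rule has_derivative_compose) (rule f)
  then show ?case
    by (rule times_differentiable_SucI) (intro Suc.IH f)
qed

lemma times_differentiable_mult:
  fixes f g :: "'a::real_normed_vector \<Rightarrow> real"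
  shows "times_differentiable k f \<Longrightarrow> times_differentiable k g \<Longrightarrow> times_differentiable k (\<lambda>x. f x * g x)"
proof (induction k arbitrary: f g)
  case 0
  then show ?case by (auto intro: continuous_intros)
next
  case (Suc k)
  note f = times_differentiable_SucD[OF Suc.prems(1)]
  note g = times_differentiable_SucD[OF Suc.prems(2)]
  note fg = Suc.prems[THEN times_differentiable_less_order]
  show ?case
    by (rule times_differentiable_SucI)
      (rule has_derivative_mult[OF f(1) g(1)], intro times_differentiable_add Suc.IH f g fg)
qed

lemma times_differentiable_prod:
  fixes f :: "'i \<Rightarrow> 'a::real_normed_vector \<Rightarrow> real"
  assumes "\<And>i. i \<in> I \<Longrightarrow> times_differentiable k (f i)"
  shows "times_differentiable k (\<lambda>x. \<Prod>i\<in>I. f i x)"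
proof (cases "finite I")
  case True
  from True assms show ?thesis
    by (induction I) (auto intro: times_differentiable_const times_differentiable_mult)
qed (auto intro: times_differentiable_const)

section \<open>Smooth bump functions on boxes\<close>
text \<open>The function \<open>s\<^sup>-\<^sup>k exp(-1/s)\<close>, extended by zero to \<open>s \<le> 0\<close>.  The parameter \<open>k\<close> makes the family
closed under differentiation up to linear combinations, so that smoothness of all members follows by
one induction.\<close>
definition flat :: "nat \<Rightarrow> real \<Rightarrow> real" where
  "flat k s = (if s > 0 then exp (- inverse s) * inverse s ^ k else 0)"

text \<open>With \<open>y = 1/s\<close> this is the decay of \<open>y\<^sup>k exp(-y)\<close> at infinity.\<close>
lemma flat_tendsto_0: "(flat k \<longlongrightarrow> 0) (at 0)"
proof (rule filterlim_split_at)
  have "((\<lambda>x::real. 0) \<longlongrightarrow> 0) (at_left (0::real))" by simp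
  then show "(flat k \<longlongrightarrow> 0) (at_left 0)"
    by (rule tendsto_cong[THEN iffD1, rotated])
      (auto simp: flat_def eventually_at intro: exI[of _ 1])
  have "((\<lambda>s::real. inverse s ^ k / exp (inverse s)) \<longlongrightarrow> 0) (at_right 0)"
    by (rule filterlim_compose[OF tendsto_power_div_exp_0 filterlim_inverse_at_top_right])
  then show "(flat k \<longlongrightarrow> 0) (at_right 0)"
    by (rule tendsto_cong[THEN iffD1, rotated])
      (auto simp: flat_def eventually_at exp_minus field_simps intro: exI[of _ 1])
qed

lemma flat_has_derivative: "(flat k has_real_derivative (flat (k + 2) s - k * flat (k + 1) s)) (at s)"
proof (cases s "0::real" rule: linorder_cases)
  case less
  have "((\<lambda>s::real. 0) has_real_derivative 0) (at s)" by simp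
  then have "(flat k has_real_derivative 0) (at s)"
    by (rule has_field_derivative_transform_within_open[where S = "{..<0}"])
      (use less in \<open>auto simp: flat_def\<close>)
  then show ?thesis using less by (simp add: flat_def)
next
  case equal
  \<comment> \<open>The difference quotient at 0 is the next member of the family.\<close>
  have "((\<lambda>y. (flat k y - flat k 0) / (y - 0)) \<longlongrightarrow> 0) (at 0)"
    by (rule tendsto_cong[THEN iffD1, OF _ flat_tendsto_0[of "Suc k"]])
      (auto simp: flat_def field_simps)
  then show ?thesis
    using equal by (simp add: has_field_derivative_iff flat_def)
next
  case greater
  have "((\<lambda>s. exp (- inverse s) * inverse s ^ k) has_real_derivative
      (flat (k + 2) s - k * flat (k + 1) s)) (at s)"
  proof -
    have "((\<lambda>s. inverse s ^ k) has_real_derivative - (k * inverse s ^ (k + 1))) (at s)"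
    proof (induction k)
      case (Suc k)
      have "((\<lambda>s. inverse s * inverse s ^ k) has_real_derivative
          - (Suc k * inverse s ^ (Suc k + 1))) (at s)"
        by (rule DERIV_cong[OF DERIV_mult[OF DERIV_inverse Suc]])
          (use greater in \<open>auto simp: field_simps power2_eq_square\<close>)
      then show ?case by simp
    qed simp
    note pow = this
    have "((\<lambda>s. exp (- inverse s)) has_real_derivative
        exp (- inverse s) * inverse s ^ 2) (at s)"
      using greater by (auto intro!: derivative_eq_intros simp: field_simps power2_eq_square)
    from DERIV_mult[OF this pow] show ?thesis
      by (rule DERIV_cong)
        (use greater in \<open>auto simp: flat_def power_add power2_eq_square algebra_simps\<close>)
  qed
  then show ?thesis
    by (rule has_field_derivative_transform_within_open[where S = "{0<..}"])
      (use greater in \<open>auto simp: flat_def\<close>)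
qed

lemma times_differentiable_flat: "times_differentiable n (flat k)"
proof (induction n arbitrary: k)
  case 0
  have "isCont (flat k) s" for s
    using flat_has_derivative by (rule DERIV_isCont)
  then show ?case by (simp add: continuous_at_imp_continuous_on)
next
  case (Suc n)
  show ?case
  proof (rule times_differentiable_SucI)
    show "(flat k has_derivative (*) (flat (k + 2) s - k * flat (k + 1) s)) (at s)" for s
      using flat_has_derivative by (simp add: has_field_derivative_def)
    show "times_differentiable n (\<lambda>s. (flat (k + 2) s - k * flat (k + 1) s) * h)" for h
      unfolding diff_conv_add_uminus mult_minus_left[symmetric]
      by (intro times_differentiable_mult times_differentiable_add times_differentiable_const Suc)
  qed
qed

text \<open>The support itself is a closure; a compact superset of the nonzero set is easier to exhibit.\<close>
lemma test_functionsI: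
  assumes "\<And>k. times_differentiable k \<phi>" "{x. \<phi> x \<noteq> 0} \<subseteq> K" "compact K" "K \<subseteq> \<Omega>"
  shows "\<phi> \<in> test_functions \<Omega>"
proof -
  have "closure {x. \<phi> x \<noteq> 0} \<subseteq> K"
    using assms by (intro closure_minimal compact_imp_closed)
  moreover from this have "compact (closure {x. \<phi> x \<noteq> 0})"
    using assms(3) by (metis Int_absorb2 closed_Int_compact closed_closure)
  ultimately show ?thesis
    using assms(1,4) unfolding test_functions_def by blast
qed

lemma test_functionsD:
  assumes "\<phi> \<in> test_functions \<Omega>"
  shows "times_differentiable k \<phi>" "compact (closure {x. \<phi> x \<noteq> 0})" "closure {x. \<phi> x \<noteq> 0} \<subseteq> \<Omega>"
  using assms by (auto simp: test_functions_def)

lemma test_functions_zero: "(\<lambda>x. 0) \<in> test_functions \<Omega>"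
  by (rule test_functionsI[of _ "{}"]) (auto intro: times_differentiable_const)

lemma test_functions_add:
  assumes "\<phi> \<in> test_functions \<Omega>" "\<psi> \<in> test_functions \<Omega>"
  shows "(\<lambda>x. \<phi> x + \<psi> x) \<in> test_functions \<Omega>"
proof (rule test_functionsI)
  let ?K = "closure {x. \<phi> x \<noteq> 0} \<union> closure {x. \<psi> x \<noteq> 0}"
  show "times_differentiable k (\<lambda>x. \<phi> x + \<psi> x)" for k
    by (rule times_differentiable_add) (rule test_functionsD(1), rule assms)+
  have "{x. \<phi> x + \<psi> x \<noteq> 0} \<subseteq> {x. \<phi> x \<noteq> 0} \<union> {x. \<psi> x \<noteq> 0}"
    by auto
  then show "{x. \<phi> x + \<psi> x \<noteq> 0} \<subseteq> ?K"
    by (rule order_trans) (intro Un_mono closure_subset)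
  show "compact ?K"
    by (intro compact_Un test_functionsD(2)[OF assms(1)] test_functionsD(2)[OF assms(2)])
  show "?K \<subseteq> \<Omega>"
    by (intro Un_least test_functionsD(3)[OF assms(1)] test_functionsD(3)[OF assms(2)])
qed

lemma test_functions_linear_image:
  assumes "\<phi> \<in> test_functions \<Omega>" "bounded_linear T"
  shows "(\<lambda>x. T (\<phi> x)) \<in> test_functions \<Omega>"
proof (rule test_functionsI)
  show "times_differentiable k (\<lambda>x. T (\<phi> x))" for k
    by (rule times_differentiable_linear_comp[OF assms(2) test_functionsD(1)[OF assms(1)]])
  have "T 0 = 0"
    using assms(2) by (simp add: bounded_linear.linear linear_0)
  then have "{x. T (\<phi> x) \<noteq> 0} \<subseteq> {x. \<phi> x \<noteq> 0}"
    by auto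
  then show "{x. T (\<phi> x) \<noteq> 0} \<subseteq> closure {x. \<phi> x \<noteq> 0}"
    using closure_subset by (rule order_trans)
qed (rule test_functionsD[OF assms(1)])+

text \<open>Each factor is positive exactly on one of the half-spaces that bound the box.\<close>
lemma box_bump_test_function:
  fixes a b :: "'a::euclidean_space"
  assumes "cbox a b \<subseteq> \<Omega>" "t > 0"
  shows "(\<lambda>x. \<Prod>i\<in>Basis. flat 0 (t * (x \<bullet> i - a \<bullet> i)) * flat 0 (t * (b \<bullet> i - x \<bullet> i)))
    \<in> test_functions \<Omega>" (is "?\<beta> \<in> _")
proof (rule test_functionsI)
  fix k
  have lin: "bounded_linear (\<lambda>x::'a. c * (x \<bullet> i))" for c i
    by (intro bounded_linear_const_mult bounded_linear_inner_left)
  have l: "times_differentiable k (\<lambda>x::'a. flat 0 (c * (x \<bullet> i) + d))" for c d i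
    by (rule times_differentiable_comp_affine[OF lin times_differentiable_flat])
  show "times_differentiable k ?\<beta>"
  proof (intro times_differentiable_prod times_differentiable_mult)
    fix i
    show "times_differentiable k (\<lambda>x. flat 0 (t * (x \<bullet> i - a \<bullet> i)))"
      using l[of t i "- t * (a \<bullet> i)"] by (simp add: right_diff_distrib)
    show "times_differentiable k (\<lambda>x. flat 0 (t * (b \<bullet> i - x \<bullet> i)))"
      using l[of "- t" i "t * (b \<bullet> i)"] by (simp add: right_diff_distrib)
  qed
  show "{x. ?\<beta> x \<noteq> 0} \<subseteq> cbox a b"
  proof
    fix x assume "x \<in> {x. ?\<beta> x \<noteq> 0}"
    then have nz: "?\<beta> x \<noteq> 0" by (rule CollectD)
    have "a \<bullet> i \<le> x \<bullet> i \<and> x \<bullet> i \<le> b \<bullet> i" if "i \<in> Basis" for i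
    proof -
      have "flat 0 (t * (x \<bullet> i - a \<bullet> i)) * flat 0 (t * (b \<bullet> i - x \<bullet> i)) \<noteq> 0"
        using nz prod_zero_iff[OF finite_Basis] that by blast
      then have "0 < t * (x \<bullet> i - a \<bullet> i)" "0 < t * (b \<bullet> i - x \<bullet> i)"
        by (metis flat_def mult_zero_left, metis flat_def mult_zero_right)
      then show ?thesis
        using zero_less_mult_pos[OF _ assms(2)] by (meson diff_gt_0_iff_gt less_imp_le)
    qed
    then show "x \<in> cbox a b" by (simp add: mem_box)
  qed
qed (use assms in auto)

lemma box_bump_bounds:
  "norm (\<Prod>i\<in>Basis. flat 0 (t * (x \<bullet> i - a \<bullet> i)) * flat 0 (t * (b \<bullet> i - x \<bullet> i))) \<le> 1"
proof -
  have "0 \<le> flat 0 s" "flat 0 s \<le> 1" for s by (auto simp: flat_def)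
  then have "0 \<le> flat 0 s * flat 0 r \<and> flat 0 s * flat 0 r \<le> 1" for r s
    by (simp add: mult_le_one)
  then have "\<bar>flat 0 s * flat 0 r\<bar> \<le> 1 \<and> 0 \<le> \<bar>flat 0 s * flat 0 r\<bar>" for r s
    by (metis abs_ge_zero abs_of_nonneg)
  then show ?thesis
    unfolding real_norm_def abs_prod by (intro prod_le_1) blast
qed

text \<open>Rescaling drives \<open>exp(-1/(ns))\<close> to 1 for every \<open>s > 0\<close>, so the bumps fill the open box.\<close>
lemma box_bump_tendsto_indicator:
  "(\<lambda>n. \<Prod>i\<in>Basis. flat 0 (real (Suc n) * (x \<bullet> i - a \<bullet> i)) * flat 0 (real (Suc n) * (b \<bullet> i - x \<bullet> i)))
    \<longlonglongrightarrow> indicator (box a b) x"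
proof -
  have flat_lim: "(\<lambda>n. flat 0 (real (Suc n) * s)) \<longlonglongrightarrow> of_bool (s > 0)" for s :: real
  proof (cases "s > 0")
    case True
    have "(\<lambda>n. exp (- (inverse s * inverse (real (Suc n))))) \<longlonglongrightarrow> exp (- (inverse s * 0))"
      by (intro tendsto_intros LIMSEQ_inverse_real_of_nat)
    with True show ?thesis by (simp add: flat_def inverse_mult_distrib mult.commute del: of_nat_Suc)
  next
    case False
    then have "flat 0 (real (Suc n) * s) = 0" for n
      by (simp add: flat_def zero_less_mult_iff)
    with False show ?thesis by simp
  qed
  have "(\<lambda>n. \<Prod>i\<in>Basis. flat 0 (real (Suc n) * (x \<bullet> i - a \<bullet> i)) * flat 0 (real (Suc n) * (b \<bullet> i - x \<bullet> i)))
      \<longlonglongrightarrow> (\<Prod>i\<in>Basis. of_bool (x \<bullet> i - a \<bullet> i > 0) * of_bool (b \<bullet> i - x \<bullet> i > 0))"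
    by (intro tendsto_prod tendsto_mult flat_lim)
  also have "(\<Prod>i\<in>Basis. of_bool (x \<bullet> i - a \<bullet> i > 0) * of_bool (b \<bullet> i - x \<bullet> i > 0))
      = (indicator (box a b) x :: real)"
    by (auto simp: indicator_def mem_box prod_eq_1_iff)
  finally show ?thesis .
qed

section \<open>The fundamental lemma of the calculus of variations\<close>
text \<open>Open boxes are stable under intersection and generate the Borel sets, and the sets over which \<open>f\<close>
integrates to zero form a Dynkin system; the assumption on the total integral gives its complements.\<close>
lemma AE_zero_if_box_integrals_zero:
  fixes f :: "'a::euclidean_space \<Rightarrow> real"
  assumes int: "integrable lborel f"
    and box: "\<And>a b. (\<integral>x. indicator (box a b) x * f x \<partial>lborel) = 0"
    and total: "(\<integral>x. f x \<partial>lborel) = 0"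
  shows "AE x in lborel. f x = 0"
proof -
  note [measurable] = borel_measurable_integrable[OF int]
  have set_int: "set_integrable lborel A f" if "A \<in> sets borel" for A
    using integrable_mult_indicator[OF _ int, of A] that by (simp add: set_integrable_def)
  have "(\<integral>x\<in>A. f x \<partial>lborel) = 0" if "A \<in> sets borel" for A
  proof -
    have "Int_stable (range (\<lambda>(a, b). box a b :: 'a set))"
      by (auto simp: Int_stable_def box_Int_box)
    moreover have "range (\<lambda>(a, b). box a b :: 'a set) \<subseteq> Pow UNIV"
      by auto
    moreover have "A \<in> sigma_sets UNIV (range (\<lambda>(a, b). box a b))"
      using that unfolding borel_eq_box by simp
    ultimately show ?thesis
    proof (induction rule: sigma_sets_induct_disjoint)
      case (basic A)
      then show ?case using box by (auto simp: set_lebesgue_integral_def)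
    next
      case empty
      then show ?case by (simp add: set_lebesgue_integral_def)
    next
      case (compl A)
      then have [measurable]: "A \<in> sets borel" by (simp add: borel_eq_box)
      have "(\<integral>x\<in>UNIV - A. f x \<partial>lborel)
          = (\<integral>x. f x - indicator A x *\<^sub>R f x \<partial>lborel)"
        unfolding set_lebesgue_integral_def
        by (intro Bochner_Integration.integral_cong) (auto simp: indicator_def)
      also have "\<dots> = (\<integral>x. f x \<partial>lborel) - (\<integral>x\<in>A. f x \<partial>lborel)"
        using int set_int[of A] by (simp add: set_lebesgue_integral_def set_integrable_def)
      finally show ?case using compl total by simp
    next
      case (union A)
      then have A: "\<And>i. A i \<in> sets borel" by (auto simp: borel_eq_box)
      have "(\<integral>x\<in>(\<Union>i. A i). f x \<partial>lborel) = (\<Sum>i. \<integral>x\<in>A i. f x \<partial>lborel)"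
        using A union(1) set_int
        by (intro lebesgue_integral_countable_add) (auto simp: disjoint_family_on_def)
      then show ?case using union by simp
    qed
  qed
  then have "AE x in lborel. f x = (\<lambda>x. 0) x"
    by (intro density_unique_real int) auto
  then show ?thesis by simp
qed

lemma integral_lebesgue_on:
  fixes f :: "'a::euclidean_space \<Rightarrow> 'b::euclidean_space"
  assumes "open \<Omega>"
  shows "(\<integral>x. f x \<partial>lebesgue_on \<Omega>) = (\<integral>x. indicator \<Omega> x *\<^sub>R f x \<partial>lebesgue)"
    and "integrable (lebesgue_on \<Omega>) f \<longleftrightarrow> integrable lebesgue (\<lambda>x. indicator \<Omega> x *\<^sub>R f x)"
  using assms by (auto intro!: integral_restrict_space integrable_restrict_space)

lemma AE_lebesgue_on_iff:
  assumes "open \<Omega>"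
  shows "(AE x in lebesgue_on \<Omega>. P x) \<longleftrightarrow> (AE x in lebesgue. x \<in> \<Omega> \<longrightarrow> P x)"
  using assms by (intro AE_restrict_space_iff) auto

lemma test_function_continuous:
  assumes "\<phi> \<in> test_functions \<Omega>"
  shows "continuous_on UNIV \<phi>"
  using test_functionsD(1)[OF assms, of 0] by simp

lemma borel_measurable_test_function:
  fixes \<phi> :: "'a::euclidean_space \<Rightarrow> 'b::euclidean_space"
  assumes "\<phi> \<in> test_functions \<Omega>"
  shows "\<phi> \<in> borel_measurable borel"
  using test_function_continuous[OF assms] by (rule borel_measurable_continuous_onI)

lemma test_function_eq_0_outside:
  assumes "\<phi> \<in> test_functions \<Omega>" "x \<notin> \<Omega>"
  shows "\<phi> x = 0"
  using test_functionsD(3)[OF assms(1)] closure_subset[of "{x. \<phi> x \<noteq> 0}"] assms(2) by blast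

text \<open>Dominated convergence along the bumps shows that the integral over every closed box in the domain
vanishes.  The domain is a countable union of such boxes, and on each of them all subboxes are
available as bump supports, which reduces the claim to \<open>AE_zero_if_box_integrals_zero\<close>.\<close>
theorem fundamental_lemma_calculus_of_variations:
  fixes w :: "'a::euclidean_space \<Rightarrow> real"
  assumes \<Omega>: "open \<Omega>" and w: "integrable (lebesgue_on \<Omega>) w"
    and zero: "\<And>\<phi>. \<phi> \<in> test_functions \<Omega> \<Longrightarrow> (\<integral>x. w x * \<phi> x \<partial>lebesgue_on \<Omega>) = 0"
  shows "AE x in lebesgue_on \<Omega>. w x = 0"
proof -
  define f where "f = (\<lambda>x. indicator \<Omega> x * w x)"
  have f: "integrable lebesgue f"
    using w integral_lebesgue_on(2)[OF \<Omega>, of w] by (simp add: f_def)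
  \<comment> \<open>A Borel version of \<open>f\<close> is needed because boxes generate only the Borel sets.\<close>
  then obtain g where g[measurable]: "g \<in> borel_measurable lborel" and "AE x in lborel. f x = g x"
    using completion_ex_borel_measurable_real[OF borel_measurable_integrable] by blast
  then have fg: "AE x in lebesgue. f x = g x"
    by (simp add: AE_completion)
  have g_int: "integrable lborel g"
  proof -
    have "integrable lebesgue g"
      using integrable_cong_AE_imp[OF f _ fg] g by (simp add: measurable_completion)
    then show ?thesis by (simp add: integrable_completion)
  qed
  have test: "(\<integral>x. \<phi> x * g x \<partial>lborel) = 0" if \<phi>: "\<phi> \<in> test_functions \<Omega>" for \<phi>
  proof -
    note [measurable] = borel_measurable_test_function[OF \<phi>]
    have "(\<integral>x. \<phi> x * g x \<partial>lborel) = (\<integral>x. \<phi> x * g x \<partial>lebesgue)"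
      by (rule integral_completion[symmetric]) simp
    also have "\<dots> = (\<integral>x. indicator \<Omega> x *\<^sub>R (w x * \<phi> x) \<partial>lebesgue)"
    proof (rule integral_cong_AE)
      show "(\<lambda>x. \<phi> x * g x) \<in> borel_measurable lebesgue"
        by (rule measurable_completion) simp
      have "(\<lambda>x. \<phi> x * f x) \<in> borel_measurable lebesgue"
        using borel_measurable_integrable[OF f] measurable_completion[of \<phi> lborel borel] by simp
      then show "(\<lambda>x. indicator \<Omega> x *\<^sub>R (w x * \<phi> x)) \<in> borel_measurable lebesgue"
        by (simp add: f_def mult_ac)
      show "AE x in lebesgue. \<phi> x * g x = indicator \<Omega> x *\<^sub>R (w x * \<phi> x)"
        using fg by eventually_elim (auto simp: f_def)
    qed
    also have "\<dots> = 0"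
      using zero[OF \<phi>] integral_lebesgue_on(1)[OF \<Omega>] by metis
    finally show ?thesis .
  qed
  have box_zero: "(\<integral>x. indicator (box p q) x * g x \<partial>lborel) = 0" if "cbox p q \<subseteq> \<Omega>" for p q
  proof -
    define \<beta> where "\<beta> n x = (\<Prod>i\<in>Basis. flat 0 (real (Suc n) * (x \<bullet> i - p \<bullet> i))
      * flat 0 (real (Suc n) * (q \<bullet> i - x \<bullet> i)))" for n x
    have \<beta>: "\<beta> n \<in> test_functions \<Omega>" for n
      unfolding \<beta>_def by (rule box_bump_test_function[OF that]) simp
    note [measurable] = borel_measurable_test_function[OF \<beta>]
    have "(\<lambda>n. \<integral>x. \<beta> n x * g x \<partial>lborel) \<longlonglongrightarrow> (\<integral>x. indicator (box p q) x * g x \<partial>lborel)"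
    proof (rule integral_dominated_convergence[where w = "\<lambda>x. norm (g x)"])
      show "AE x in lborel. (\<lambda>n. \<beta> n x * g x) \<longlonglongrightarrow> indicator (box p q) x * g x"
        unfolding \<beta>_def by (intro AE_I2 tendsto_mult_right box_bump_tendsto_indicator)
      have "norm (\<beta> n x) \<le> 1" for n x
        unfolding \<beta>_def by (rule box_bump_bounds)
      then show "AE x in lborel. norm (\<beta> n x * g x) \<le> norm (g x)" for n
        by (intro AE_I2) (simp add: abs_mult mult_left_le_one_le)
    qed (use g_int in auto)
    then show ?thesis using test[OF \<beta>] by (simp add: LIMSEQ_const_iff)
  qed
  have local: "AE x in lebesgue. x \<in> cbox c d \<longrightarrow> f x = 0" if cd: "cbox c d \<subseteq> \<Omega>" for c d
  proof -
    have int: "(\<integral>x. indicator (box a b) x * (indicator (box c d) x * g x) \<partial>lborel) = 0" for a b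
    proof -
      obtain p q where pq: "box a b \<inter> box c d = box p q"
        using box_Int_box by blast
      have eq: "indicator (box a b) x * (indicator (box c d) x * g x) = indicator (box p q) x * g x" for x
        unfolding pq[symmetric] by (simp add: indicator_inter_arith)
      show ?thesis
      proof (cases "box p q = {}")
        case False
        then have "cbox p q = closure (box a b \<inter> box c d)"
          by (simp add: pq)
        also have "\<dots> \<subseteq> closure (box c d)"
          by (intro closure_mono) auto
        also have "\<dots> \<subseteq> cbox c d"
          by (intro closure_minimal box_subset_cbox closed_cbox)
        finally show ?thesis unfolding eq using cd by (intro box_zero) auto
      qed (simp add: eq)
    qed
    have "AE x in lborel. indicator (box c d) x * g x = 0"
    proof (rule AE_zero_if_box_integrals_zero[OF _ int])
      show "integrable lborel (\<lambda>x. indicator (box c d) x * g x)"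
        using integrable_mult_indicator[OF _ g_int, of "box c d"] by simp
      show "(\<integral>x. indicator (box c d) x * g x \<partial>lborel) = 0"
        by (rule box_zero[OF cd])
    qed
    then have "AE x in lebesgue. indicator (box c d) x * g x = 0"
      by (rule AE_completion)
    moreover have "AE x in lebesgue. x \<notin> cbox c d - box c d"
      using negligible_frontier_interval[of c d] by (intro AE_not_in) (simp add: negligible_iff_null_sets)
    ultimately show ?thesis
      using fg by eventually_elim (auto simp: indicator_def split: if_splits)
  qed
  obtain \<D> where \<D>: "countable \<D>" "\<D> \<subseteq> Pow \<Omega>" "\<And>X. X \<in> \<D> \<Longrightarrow> \<exists>a b. X = cbox a b" "\<Union>\<D> = \<Omega>"
    using open_countable_Union_open_cbox[OF \<Omega>] by metis
  have "AE x in lebesgue. x \<in> X \<longrightarrow> f x = 0" if "X \<in> \<D>" for X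
    using \<D>(2,3) that local by blast
  then have "AE x in lebesgue. \<forall>X\<in>\<D>. x \<in> X \<longrightarrow> f x = 0"
    unfolding AE_ball_countable[OF \<D>(1)] by blast
  then have "AE x in lebesgue. x \<in> \<Omega> \<longrightarrow> w x = 0"
    by eventually_elim (use \<D>(4) in \<open>auto simp: f_def indicator_def split: if_splits\<close>)
  then show ?thesis
    by (simp add: AE_lebesgue_on_iff[OF \<Omega>])
qed

section \<open>Continuous functions with compact support and their directional derivatives\<close>
text \<open>The space usually written \<open>C\<^sub>c\<close>.  Boundedness of the nonzero set replaces compactness of the
support, which is equivalent in a Euclidean space.\<close>
definition Cc :: "('a::euclidean_space \<Rightarrow> 'b::euclidean_space) \<Rightarrow> bool" where
  "Cc f \<longleftrightarrow> continuous_on UNIV f \<and> bounded {x. f x \<noteq> 0}"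

lemma Cc_continuous: "Cc f \<Longrightarrow> continuous_on S f"
  unfolding Cc_def using continuous_on_subset by blast

lemma Cc_measurable: "Cc f \<Longrightarrow> f \<in> borel_measurable borel"
  by (auto simp: Cc_def intro: borel_measurable_continuous_onI)

lemma CcI:
  assumes "continuous_on UNIV f" "{x. f x \<noteq> 0} \<subseteq> S" "bounded S"
  shows "Cc f"
  using assms bounded_subset unfolding Cc_def by blast

lemma Cc_bounds:
  fixes f :: "'a::euclidean_space \<Rightarrow> 'b::euclidean_space"
  assumes "Cc f"
  obtains K R where "0 \<le> K" "0 \<le> R" "\<And>x. norm (f x) \<le> K" "\<And>x. R < norm x \<Longrightarrow> f x = 0"
proof -
  obtain R where R: "\<And>x. f x \<noteq> 0 \<Longrightarrow> norm x \<le> R"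
    using assms unfolding Cc_def bounded_iff by auto
  have "compact (f ` cball 0 R)"
    using assms by (intro compact_continuous_image Cc_continuous) auto
  then have "bounded (f ` cball 0 R)" by (rule compact_imp_bounded)
  then obtain K where K: "\<And>x. x \<in> cball 0 R \<Longrightarrow> norm (f x) \<le> K"
    unfolding bounded_iff by blast
  show thesis
  proof
    show "norm (f x) \<le> \<bar>K\<bar>" for x
      using R[of x] K[of x] by (cases "f x = 0") auto
    show "f x = 0" if "\<bar>R\<bar> < norm x" for x
      using R[of x] that by force
  qed auto
qed

lemma Cc_integrable:
  fixes f :: "'a::euclidean_space \<Rightarrow> 'b::euclidean_space"
  assumes "Cc f"
  shows "integrable lborel f"
proof -
  obtain K R where R: "\<And>x. R < norm x \<Longrightarrow> f x = 0"
    using Cc_bounds[OF assms] by metis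
  have "integrable lborel (\<lambda>x. indicator (cball 0 R) x *\<^sub>R f x)"
    by (rule borel_integrable_compact) (use assms Cc_continuous in auto)
  also have "(\<lambda>x. indicator (cball 0 R) x *\<^sub>R f x) = f"
    using R by (force simp: indicator_def not_le)
  finally show ?thesis .
qed

lemma Cc_linear_image:
  fixes f :: "'a::euclidean_space \<Rightarrow> 'b::euclidean_space" and T :: "'b \<Rightarrow> 'c::euclidean_space"
  assumes "Cc f" "linear T"
  shows "Cc (\<lambda>x. T (f x))"
proof (rule CcI)
  show "continuous_on UNIV (\<lambda>x. T (f x))"
    using Cc_continuous[OF assms(1)] assms(2) by (rule linear_continuous_on_compose)
  show "{x. T (f x) \<noteq> 0} \<subseteq> {x. f x \<noteq> 0}"
    using assms(2) by (auto simp: linear_0)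
qed (use assms in \<open>auto simp: Cc_def\<close>)

lemma Cc_add:
  assumes "Cc f" "Cc g"
  shows "Cc (\<lambda>x. f x + g x)"
proof (rule CcI)
  show "{x. f x + g x \<noteq> 0} \<subseteq> {x. f x \<noteq> 0} \<union> {x. g x \<noteq> 0}" by auto
  show "bounded ({x. f x \<noteq> 0} \<union> {x. g x \<noteq> 0})"
    using assms by (auto simp: Cc_def)
qed (intro continuous_on_add Cc_continuous assms)

lemma Cc_diff:
  assumes "Cc f" "Cc g"
  shows "Cc (\<lambda>x. f x - g x)"
proof (rule CcI)
  show "{x. f x - g x \<noteq> 0} \<subseteq> {x. f x \<noteq> 0} \<union> {x. g x \<noteq> 0}" by auto
  show "bounded ({x. f x \<noteq> 0} \<union> {x. g x \<noteq> 0})"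
    using assms by (auto simp: Cc_def)
qed (intro continuous_on_diff Cc_continuous assms)

lemma Cc_mult:
  fixes f g :: "'a::euclidean_space \<Rightarrow> real"
  assumes "Cc f" "Cc g"
  shows "Cc (\<lambda>x. f x * g x)"
proof (rule CcI)
  show "{x. f x * g x \<noteq> 0} \<subseteq> {x. f x \<noteq> 0}" by auto
qed (use assms[THEN Cc_continuous] assms in \<open>auto intro: continuous_intros simp: Cc_def\<close>)

lemma Cc_translate:
  assumes "Cc f"
  shows "Cc (\<lambda>x. f (x + a))"
proof (rule CcI)
  show "continuous_on UNIV (\<lambda>x. f (x + a))"
    using Cc_continuous[OF assms] by (rule continuous_on_compose2) (auto intro: continuous_intros)
  show "{x. f (x + a) \<noteq> 0} \<subseteq> (\<lambda>x. - a + x) ` {x. f x \<noteq> 0}"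
  proof
    fix x assume "x \<in> {x. f (x + a) \<noteq> 0}"
    then have "x = - a + (x + a)" "x + a \<in> {x. f x \<noteq> 0}" by auto
    then show "x \<in> (\<lambda>x. - a + x) ` {x. f x \<noteq> 0}" by (rule image_eqI)
  qed
  show "bounded ((\<lambda>x. - a + x) ` {x. f x \<noteq> 0})"
    using assms by (intro bounded_translation) (simp add: Cc_def)
qed

lemma Cc_vec:
  fixes f :: "'a::euclidean_space \<Rightarrow> ('b::euclidean_space)^'i::finite"
  assumes "\<And>i. Cc (\<lambda>x. f x $ i)"
  shows "Cc f"
proof (rule CcI)
  have "continuous_on UNIV (\<lambda>x. \<chi> i. f x $ i)"
    by (intro continuous_on_vec_lambda Cc_continuous assms)
  then show "continuous_on UNIV f" by simp
  show "{x. f x \<noteq> 0} \<subseteq> (\<Union>i. {x. f x $ i \<noteq> 0})"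
    by (auto simp: vec_eq_iff)
  show "bounded (\<Union>i. {x. f x $ i \<noteq> 0})"
    using assms by (intro bounded_Union) (auto simp: Cc_def)
qed

lemma Cc_norm_power2:
  assumes "Cc f"
  shows "Cc (\<lambda>x. (norm (f x))\<^sup>2)"
proof (rule CcI)
  show "{x. (norm (f x))\<^sup>2 \<noteq> 0} \<subseteq> {x. f x \<noteq> 0}" by auto
  show "continuous_on UNIV (\<lambda>x. (norm (f x))\<^sup>2)"
    by (intro continuous_on_power continuous_on_norm Cc_continuous assms)
qed (use assms in \<open>simp add: Cc_def\<close>)

lemma Cc_L2:
  fixes f :: "'a::euclidean_space \<Rightarrow> 'b::euclidean_space"
  assumes "Cc f" "open \<Omega>"
  shows "f \<in> L2 \<Omega>"
proof -
  have int: "integrable lebesgue (\<lambda>x. (norm (f x))\<^sup>2)"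
    using Cc_integrable[OF Cc_norm_power2[OF assms(1)]] Cc_measurable[OF assms(1)]
    by (subst integrable_completion) auto
  have "integrable lebesgue (\<lambda>x. indicator \<Omega> x *\<^sub>R (norm (f x))\<^sup>2)"
    by (rule integrable_mult_indicator[OF _ int]) (use assms(2) in auto)
  moreover have "f \<in> borel_measurable lebesgue"
    using Cc_measurable[OF assms(1)] by (intro measurable_completion) simp
  ultimately show ?thesis
    unfolding L2_def integral_lebesgue_on(2)[OF assms(2)]
    by (intro CollectI conjI measurable_restrict_space1)
qed

lemma L2_norm_UNIV:
  fixes f :: "'a::euclidean_space \<Rightarrow> 'b::euclidean_space"
  assumes "Cc f"
  shows "(L2_norm UNIV f)\<^sup>2 = (\<integral>x. (norm (f x))\<^sup>2 \<partial>lborel)"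
proof -
  have "(L2_norm UNIV f)\<^sup>2 = (\<integral>x. (norm (f x))\<^sup>2 \<partial>lebesgue)"
    unfolding L2_norm_power2 integral_lebesgue_on(1)[OF open_UNIV] by simp
  also have "\<dots> = (\<integral>x. (norm (f x))\<^sup>2 \<partial>lborel)"
    using Cc_measurable[OF assms] by (intro integral_completion) auto
  finally show ?thesis .
qed

lemma integral_translate:
  fixes f :: "'a::euclidean_space \<Rightarrow> 'b::euclidean_space"
  assumes "f \<in> borel_measurable borel"
  shows "(\<integral>x. f (x + a) \<partial>lborel) = (\<integral>x. f x \<partial>lborel)"
proof -
  have "(\<integral>x. f x \<partial>lborel) = (\<integral>x. f x \<partial>distr lborel borel ((+) a))"
    by (simp add: lborel_distr_plus)
  also have "\<dots> = (\<integral>x. f (a + x) \<partial>lborel)"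
    using assms by (intro integral_distr) auto
  finally show ?thesis by (simp add: add.commute)
qed

text \<open>Directional derivatives suffice everywhere below and are easier than total derivatives to obtain
for integrals over segments.\<close>
definition has_dir_derivative ::
  "('a::euclidean_space \<Rightarrow> real) \<Rightarrow> 'a \<Rightarrow> ('a \<Rightarrow> real) \<Rightarrow> bool" where
  "has_dir_derivative f e g \<longleftrightarrow> (\<forall>x. ((\<lambda>t. f (x + t *\<^sub>R e)) has_real_derivative g x) (at 0))"

lemma has_dir_derivativeD:
  assumes "has_dir_derivative f e g"
  shows "((\<lambda>t. f (x + t *\<^sub>R e)) has_real_derivative g (x + s *\<^sub>R e)) (at s)"
proof -
  have "((\<lambda>t. f (x + s *\<^sub>R e + t *\<^sub>R e)) has_real_derivative g (x + s *\<^sub>R e)) (at 0)"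
    using assms by (simp add: has_dir_derivative_def)
  then have "((\<lambda>t. f (x + (s + t) *\<^sub>R e)) has_real_derivative g (x + s *\<^sub>R e)) (at 0)"
    by (simp add: scaleR_add_left add.assoc)
  then show ?thesis
    using DERIV_shift[of "\<lambda>t. f (x + t *\<^sub>R e)" "g (x + s *\<^sub>R e)" 0 s] by (simp add: add.commute)
qed

definition difference_quotient :: "real \<Rightarrow> 'a::euclidean_space \<Rightarrow> ('a \<Rightarrow> real) \<Rightarrow> 'a \<Rightarrow> real" where
  "difference_quotient t e f x = (f (x + t *\<^sub>R e) - f x) / t"

lemma difference_quotient_tendsto:
  assumes "has_dir_derivative f e g" "t \<longlonglongrightarrow> 0" "\<And>n. t n \<noteq> 0"
  shows "(\<lambda>n. difference_quotient (t n) e f x) \<longlonglongrightarrow> g x"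
proof -
  have "((\<lambda>t. (f (x + t *\<^sub>R e) - f (x + 0 *\<^sub>R e)) / (t - 0)) \<longlongrightarrow> g x) (at 0)"
    using assms(1) unfolding has_dir_derivative_def has_field_derivative_iff by blast
  moreover have "filterlim t (at 0) sequentially"
    using assms(2,3) by (simp add: filterlim_at)
  ultimately show ?thesis
    using filterlim_compose by (fastforce simp: difference_quotient_def)
qed

lemma difference_quotient_bound:
  assumes "has_dir_derivative f e g" "\<And>x. norm (g x) \<le> K" "t \<noteq> 0"
  shows "norm (difference_quotient t e f x) \<le> K"
proof -
  have "norm (f (x + t *\<^sub>R e) - f (x + 0 *\<^sub>R e)) \<le> K * norm (t - 0)"
    by (rule field_differentiable_bound[where S = UNIV])
      (use assms(1,2) has_dir_derivativeD in auto)
  then show ?thesis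
    using assms(3) by (simp add: difference_quotient_def field_simps)
qed

lemma difference_quotient_measurable:
  "Cc f \<Longrightarrow> difference_quotient t e f \<in> borel_measurable borel"
  using Cc_measurable[of f] unfolding difference_quotient_def[abs_def] by measurable

text \<open>Difference quotients are bounded by the supremum of the derivative (mean value inequality), and for
steps of size at most 1 their supports lie in a fixed ball, so dominated convergence applies.\<close>
lemma integral_difference_quotient_mult_tendsto:
  fixes f h0 :: "'a::euclidean_space \<Rightarrow> real" and h :: "nat \<Rightarrow> 'a \<Rightarrow> real"
  assumes f: "Cc f" "Cc g" "has_dir_derivative f a g"
    and s: "s \<longlonglongrightarrow> 0" "\<And>n. s n \<noteq> 0" "\<And>n. \<bar>s n\<bar> \<le> 1"
    and h: "\<And>n. h n \<in> borel_measurable borel" "h0 \<in> borel_measurable borel"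
      "\<And>x. (\<lambda>n. h n x) \<longlonglongrightarrow> h0 x" "\<And>n x. norm (h n x) \<le> M"
  shows "(\<lambda>n. \<integral>x. difference_quotient (s n) a f x * h n x \<partial>lborel) \<longlonglongrightarrow> (\<integral>x. g x * h0 x \<partial>lborel)"
proof -
  obtain K where K: "0 \<le> K" "\<And>x. norm (g x) \<le> K"
    using Cc_bounds[OF f(2)] by metis
  obtain R where R: "\<And>x. R < norm x \<Longrightarrow> f x = 0"
    using Cc_bounds[OF f(1)] by metis
  have M: "0 \<le> M" using h(4)[of 0 0] norm_ge_zero order_trans by blast
  note [measurable] = Cc_measurable[OF f(2)] difference_quotient_measurable[OF f(1)] h(1,2)
  show ?thesis
  proof (rule integral_dominated_convergence[where w = "\<lambda>x. indicator (cball 0 (R + norm a)) x *\<^sub>R (K * M)"])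
    show "integrable lborel (\<lambda>x::'a. indicator (cball 0 (R + norm a)) x *\<^sub>R (K * M))"
      by (rule borel_integrable_compact) auto
    show "AE x in lborel. (\<lambda>n. difference_quotient (s n) a f x * h n x) \<longlonglongrightarrow> g x * h0 x"
      by (intro AE_I2 tendsto_mult difference_quotient_tendsto[OF f(3) s(1,2)] h(3))
    show "AE x in lborel. norm (difference_quotient (s n) a f x * h n x)
        \<le> indicator (cball 0 (R + norm a)) x *\<^sub>R (K * M)" for n
    proof (rule AE_I2)
      fix x
      show "norm (difference_quotient (s n) a f x * h n x) \<le> indicator (cball 0 (R + norm a)) x *\<^sub>R (K * M)"
      proof (cases "norm x \<le> R + norm a")
        case True
        then show ?thesis
          using mult_mono[OF difference_quotient_bound[OF f(3) K(2) s(2)] h(4) K(1)]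
          by (simp add: abs_mult)
      next
        case False
        have "norm (s n *\<^sub>R a) \<le> norm a"
          using s(3)[of n] by (simp add: mult_left_le_one_le)
        moreover have "norm x \<le> norm (x + s n *\<^sub>R a) + norm (s n *\<^sub>R a)"
          by (metis add_diff_cancel_right' norm_triangle_ineq4)
        ultimately have "R < norm x" "R < norm (x + s n *\<^sub>R a)"
          using False norm_ge_zero[of a] by linarith+
        then show ?thesis using R K(1) M by (simp add: difference_quotient_def)
      qed
    qed
  qed simp_all
qed

lemma integral_difference_quotient_pairing_tendsto:
  fixes f1 f2 :: "'a::euclidean_space \<Rightarrow> real"
  assumes f1: "Cc f1" "Cc g1" "has_dir_derivative f1 a g1"
    and f2: "Cc f2" "Cc g2" "has_dir_derivative f2 b g2"
    and s: "s \<longlonglongrightarrow> 0" "\<And>n. s n \<noteq> 0" "\<And>n. \<bar>s n\<bar> \<le> 1"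
  shows "(\<lambda>n. \<integral>x. difference_quotient (s n) a f1 x * difference_quotient (s n) b f2 x \<partial>lborel) \<longlonglongrightarrow> (\<integral>x. g1 x * g2 x \<partial>lborel)"
proof -
  obtain K2 where K2: "\<And>x. norm (g2 x) \<le> K2"
    using Cc_bounds[OF f2(2)] by metis
  show ?thesis
    by (rule integral_difference_quotient_mult_tendsto[OF f1 s difference_quotient_measurable[OF f2(1)] Cc_measurable[OF f2(2)]
          difference_quotient_tendsto[OF f2(3) s(1,2)] difference_quotient_bound[OF f2(3) K2 s(2)]])
qed

text \<open>Translation invariance makes the integral of every difference quotient vanish.\<close>
lemma integral_dir_derivative_eq_0:
  fixes f :: "'a::euclidean_space \<Rightarrow> real"
  assumes "Cc f" "Cc g" "has_dir_derivative f e g"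
  shows "(\<integral>x. g x \<partial>lborel) = 0"
proof -
  define s where "s n = inverse (real (Suc n))" for n
  have s: "s \<longlonglongrightarrow> 0" "\<And>n. s n \<noteq> 0" "\<And>n. \<bar>s n\<bar> \<le> 1"
    unfolding s_def using LIMSEQ_inverse_real_of_nat by (auto simp: inverse_le_1_iff)
  have "(\<integral>x. difference_quotient t e f x * 1 \<partial>lborel) = 0" for t
    using integral_translate[OF Cc_measurable[OF assms(1)], of "t *\<^sub>R e"]
      Cc_integrable[OF assms(1)] Cc_integrable[OF Cc_translate[OF assms(1)], of "t *\<^sub>R e"]
    by (simp add: difference_quotient_def)
  moreover have "(\<lambda>n. \<integral>x. difference_quotient (s n) e f x * 1 \<partial>lborel) \<longlonglongrightarrow> (\<integral>x. g x * 1 \<partial>lborel)"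
    by (rule integral_difference_quotient_mult_tendsto[OF assms s, where M = 1]) auto
  ultimately show ?thesis
    by (simp add: LIMSEQ_const_iff)
qed

lemma integral_by_parts_dir_derivative:
  fixes f g :: "'a::euclidean_space \<Rightarrow> real"
  assumes f: "Cc f" "Cc f'" "has_dir_derivative f e f'" and g: "Cc g" "Cc g'" "has_dir_derivative g e g'"
  shows "(\<integral>x. f' x * g x \<partial>lborel) = - (\<integral>x. f x * g' x \<partial>lborel)"
proof -
  have "has_dir_derivative (\<lambda>x. f x * g x) e (\<lambda>x. f' x * g x + f x * g' x)"
    using f(3) g(3) unfolding has_dir_derivative_def
    by (auto intro!: derivative_eq_intros simp: mult.commute)
  moreover have int: "Cc (\<lambda>x. f' x * g x)" "Cc (\<lambda>x. f x * g' x)"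
    by (intro Cc_mult f g)+
  ultimately have "(\<integral>x. f' x * g x + f x * g' x \<partial>lborel) = 0"
    by (intro integral_dir_derivative_eq_0[of "\<lambda>x. f x * g x"] Cc_mult Cc_add f g)
  then show ?thesis
    using int[THEN Cc_integrable] by simp
qed

text \<open>For twice differentiable functions this follows by integrating by parts twice.  Here the functions
are only once differentiable, and the same computation is done with difference quotients: translation
operators commute, so the identity is exact for finite steps (with the sign of the step reversed) and
passes to the limit.\<close>
lemma integral_dir_derivatives_swap:
  fixes f1 f2 :: "'a::euclidean_space \<Rightarrow> real"
  assumes f1: "Cc f1" "Cc f1a" "Cc f1b" "has_dir_derivative f1 a f1a" "has_dir_derivative f1 b f1b"
    and f2: "Cc f2" "Cc f2a" "Cc f2b" "has_dir_derivative f2 a f2a" "has_dir_derivative f2 b f2b"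
  shows "(\<integral>x. f1a x * f2b x \<partial>lborel) = (\<integral>x. f1b x * f2a x \<partial>lborel)"
proof -
  have swap: "(\<integral>x. difference_quotient t a f1 x * difference_quotient t b f2 x \<partial>lborel)
      = (\<integral>x. difference_quotient (- t) b f1 x * difference_quotient (- t) a f2 x \<partial>lborel)" for t
  proof -
    define p where "p c d = (\<integral>x. f1 (x + c) * f2 (x + d) \<partial>lborel)" for c d
    have int: "integrable lborel (\<lambda>x. f1 (x + c) * f2 (x + d))" for c d
      by (intro Cc_integrable Cc_mult Cc_translate f1 f2)
    \<comment> \<open>The correlation \<open>p c d\<close> depends only on \<open>c - d\<close>.\<close>
    have p_shift: "p (c + h) (d + h) = p c d" for c d h
      unfolding p_def using integral_translate[OF Cc_measurable[OF Cc_mult[OF Cc_translate[OF f1(1), of c]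
          Cc_translate[OF f2(1), of d]]], of h]
      by (simp add: algebra_simps)
    have expand: "(\<integral>x. difference_quotient t c f1 x * difference_quotient t d f2 x \<partial>lborel)
        = (p (t *\<^sub>R c) (t *\<^sub>R d) - p (t *\<^sub>R c) 0 - p 0 (t *\<^sub>R d) + p 0 0) / t\<^sup>2" for t c d
    proof -
      have "(\<integral>x. difference_quotient t c f1 x * difference_quotient t d f2 x \<partial>lborel)
        = (\<integral>x. (f1 (x + t *\<^sub>R c) * f2 (x + t *\<^sub>R d) - f1 (x + t *\<^sub>R c) * f2 (x + 0)
            - f1 (x + 0) * f2 (x + t *\<^sub>R d) + f1 (x + 0) * f2 (x + 0)) / t\<^sup>2 \<partial>lborel)"
        by (intro Bochner_Integration.integral_cong)
          (auto simp: difference_quotient_def power2_eq_square divide_simps algebra_simps)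
      then show ?thesis
        unfolding p_def using int[of "t *\<^sub>R c" "t *\<^sub>R d"] int[of "t *\<^sub>R c" 0] int[of 0 "t *\<^sub>R d"] int[of 0 0]
        by simp
    qed
    show ?thesis
      unfolding expand
      using p_shift[of "(-t) *\<^sub>R b" "t *\<^sub>R a + t *\<^sub>R b" "(-t) *\<^sub>R a"]
        p_shift[of 0 "t *\<^sub>R a" "(-t) *\<^sub>R a"] p_shift[of "(-t) *\<^sub>R b" "t *\<^sub>R b" 0]
      by (simp add: algebra_simps)
  qed
  define s where "s n = inverse (real (Suc n))" for n
  have s: "s \<longlonglongrightarrow> 0" "\<And>n. s n \<noteq> 0" "\<And>n. \<bar>s n\<bar> \<le> 1"
    unfolding s_def using LIMSEQ_inverse_real_of_nat by (auto simp: inverse_le_1_iff)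
  have "(\<lambda>n. \<integral>x. difference_quotient (s n) a f1 x * difference_quotient (s n) b f2 x \<partial>lborel) \<longlonglongrightarrow> (\<integral>x. f1a x * f2b x \<partial>lborel)"
    by (rule integral_difference_quotient_pairing_tendsto[OF f1(1,2,4) f2(1,3,5) s])
  moreover have "(\<lambda>n. \<integral>x. difference_quotient (- s n) b f1 x * difference_quotient (- s n) a f2 x \<partial>lborel)
      \<longlonglongrightarrow> (\<integral>x. f1b x * f2a x \<partial>lborel)"
    using s tendsto_minus[OF s(1)]
    by (intro integral_difference_quotient_pairing_tendsto[OF f1(1,3,5) f2(1,2,4), where s = "\<lambda>n. - s n"]) auto
  ultimately show ?thesis
    unfolding swap by (rule LIMSEQ_unique)
qed

section \<open>The classical curl of a test field\<close>
lemma has_derivative_test_function: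
  assumes "\<phi> \<in> test_functions \<Omega>"
  shows "(\<phi> has_derivative frechet_derivative \<phi> (at x)) (at x)"
  using times_differentiable_SucD(1)[OF test_functionsD(1)[OF assms, of "Suc 0"]] .

lemma Cc_test_function:
  fixes \<phi> :: "'a::euclidean_space \<Rightarrow> 'b::euclidean_space"
  assumes "\<phi> \<in> test_functions \<Omega>"
  shows "Cc \<phi>"
  using test_function_continuous[OF assms] closure_subset
    compact_imp_bounded[OF test_functionsD(2)[OF assms]] by (rule CcI)

lemma frechet_derivative_test_function_support:
  assumes "\<phi> \<in> test_functions \<Omega>"
  shows "{x. frechet_derivative \<phi> (at x) h \<noteq> 0} \<subseteq> closure {x. \<phi> x \<noteq> 0}"
proof (rule subsetI, rule ccontr)
  fix x assume nz: "x \<in> {x. frechet_derivative \<phi> (at x) h \<noteq> 0}" and x: "x \<notin> closure {x. \<phi> x \<noteq> 0}"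
  have "((\<lambda>x. 0) has_derivative (\<lambda>h. 0)) (at x)" by simp
  then have "(\<phi> has_derivative (\<lambda>h. 0)) (at x)"
  proof (rule has_derivative_transform_within_open)
    show "open (- closure {x. \<phi> x \<noteq> 0})"
      by (intro open_Compl closed_closure)
    show "0 = \<phi> y" if "y \<in> - closure {x. \<phi> x \<noteq> 0}" for y
      using that closure_subset[of "{x. \<phi> x \<noteq> 0}"] by auto
  qed (use x in auto)
  then show False
    using nz by (simp add: frechet_derivative_eqI)
qed

lemma Cc_frechet_derivative:
  fixes \<phi> :: "'a::euclidean_space \<Rightarrow> 'b::euclidean_space"
  assumes "\<phi> \<in> test_functions \<Omega>"
  shows "Cc (\<lambda>x. frechet_derivative \<phi> (at x) h)"
proof (rule CcI)
  show "continuous_on UNIV (\<lambda>x. frechet_derivative \<phi> (at x) h)"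
    using times_differentiable_SucD(2)[OF test_functionsD(1)[OF assms, of "Suc 0"]] by simp
qed (rule frechet_derivative_test_function_support[OF assms],
    rule compact_imp_bounded[OF test_functionsD(2)[OF assms]])

lemma frechet_derivative_eq_0_outside:
  assumes "\<phi> \<in> test_functions \<Omega>" "x \<notin> \<Omega>"
  shows "frechet_derivative \<phi> (at x) h = 0"
  using frechet_derivative_test_function_support[OF assms(1)] test_functionsD(3)[OF assms(1)] assms(2)
  by blast

lemma has_dir_derivative_frechet:
  fixes \<phi> :: "'a::euclidean_space \<Rightarrow> real"
  assumes "\<And>x. (\<phi> has_derivative D x) (at x)"
  shows "has_dir_derivative \<phi> e (\<lambda>x. D x e)"
  unfolding has_dir_derivative_def
proof
  fix x
  have "((\<lambda>t. x + t *\<^sub>R e) has_derivative (\<lambda>t. t *\<^sub>R e)) (at 0)"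
    by (auto intro!: derivative_eq_intros)
  then have "((\<lambda>t. \<phi> (x + t *\<^sub>R e)) has_derivative (\<lambda>t. D (x + 0 *\<^sub>R e) (t *\<^sub>R e))) (at 0)"
    by (rule has_derivative_compose) (rule assms)
  moreover have "D x (t *\<^sub>R e) = D x e * t" for t
    using linear_scale[OF has_derivative_linear[OF assms]] by simp
  ultimately show "((\<lambda>t. \<phi> (x + t *\<^sub>R e)) has_real_derivative D x e) (at 0)"
    by (simp add: has_field_derivative_def)
qed

lemma has_dir_derivative_test_function_component:
  fixes \<phi> :: "'a::euclidean_space \<Rightarrow> real^'i::finite"
  assumes "\<phi> \<in> test_functions \<Omega>"
  shows "has_dir_derivative (\<lambda>x. \<phi> x $ i) e (\<lambda>x. frechet_derivative \<phi> (at x) e $ i)"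
  by (rule has_dir_derivative_frechet)
    (rule bounded_linear.has_derivative[OF bounded_linear_vec_nth has_derivative_test_function[OF assms]])

lemma integral_lebesgue_on_Cc:
  fixes f :: "'a::euclidean_space \<Rightarrow> 'b::euclidean_space"
  assumes "open \<Omega>" "Cc f" "\<And>x. x \<notin> \<Omega> \<Longrightarrow> f x = 0"
  shows "(\<integral>x. f x \<partial>lebesgue_on \<Omega>) = (\<integral>x. f x \<partial>lborel)"
proof -
  have "(\<integral>x. f x \<partial>lebesgue_on \<Omega>) = (\<integral>x. f x \<partial>lebesgue)"
    unfolding integral_lebesgue_on(1)[OF assms(1)]
    by (intro Bochner_Integration.integral_cong) (auto simp: indicator_def assms(3))
  also have "\<dots> = (\<integral>x. f x \<partial>lborel)"
    using Cc_measurable[OF assms(2)] by (intro integral_completion) auto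
  finally show ?thesis .
qed

lemma L2_norm_eq_UNIV:
  fixes f :: "'a::euclidean_space \<Rightarrow> 'b::euclidean_space"
  assumes "open \<Omega>" "Cc f" "\<And>x. x \<notin> \<Omega> \<Longrightarrow> f x = 0"
  shows "L2_norm \<Omega> f = L2_norm UNIV f"
proof -
  have "(\<integral>x. (norm (f x))\<^sup>2 \<partial>lebesgue_on \<Omega>) = (\<integral>x. (norm (f x))\<^sup>2 \<partial>lborel)"
    by (intro integral_lebesgue_on_Cc Cc_norm_power2 assms) (simp add: assms(3))
  then have "(L2_norm \<Omega> f)\<^sup>2 = (L2_norm UNIV f)\<^sup>2"
    unfolding L2_norm_UNIV[OF assms(2)] L2_norm_power2[of \<Omega>] .
  then show ?thesis by (simp add: L2_norm_nonneg)
qed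

text \<open>Strictly upper triangular, as required of weak curls.\<close>
definition classical_curl ::
    "(('n::{finite,linorder}) rvec \<Rightarrow> 'n rvec) \<Rightarrow> 'n rvec \<Rightarrow> 'n rmat" where
  "classical_curl \<phi> x = (\<chi> n m. if n < m
     then frechet_derivative \<phi> (at x) (axis n 1) $ m - frechet_derivative \<phi> (at x) (axis m 1) $ n else 0)"

lemma Cc_classical_curl:
  assumes "\<phi> \<in> test_functions \<Omega>"
  shows "Cc (classical_curl \<phi>)"
proof (intro Cc_vec)
  fix n m
  have "Cc (\<lambda>x. frechet_derivative \<phi> (at x) (axis i 1) $ j)" for i j
    by (rule Cc_linear_image[OF Cc_frechet_derivative[OF assms] linear_vec_nth])
  moreover have "Cc (\<lambda>x. 0 :: real)"
    by (simp add: Cc_def)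
  ultimately show "Cc (\<lambda>x. classical_curl \<phi> x $ n $ m)"
    by (cases "n < m") (auto simp: classical_curl_def intro: Cc_diff)
qed

lemma classical_curl_eq_0_outside:
  assumes "\<phi> \<in> test_functions \<Omega>" "x \<notin> \<Omega>"
  shows "classical_curl \<phi> x = 0"
  using frechet_derivative_eq_0_outside[OF assms] by (simp add: classical_curl_def vec_eq_iff)

text \<open>Integration by parts moves each derivative to the scalar test function; all integrands vanish outside
the domain, so that the integrals may be taken over the whole space.\<close>
lemma has_weak_curl_classical_curl:
  fixes \<phi> :: "('n::{finite,linorder}) rvec \<Rightarrow> 'n rvec"
  assumes \<Omega>: "open \<Omega>" and \<phi>: "\<phi> \<in> test_functions \<Omega>"
  shows "has_weak_curl \<Omega> \<phi> (classical_curl \<phi>)"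
  unfolding has_weak_curl_def
proof (intro conjI allI impI ballI)
  fix n m :: 'n and \<psi> :: "'n rvec \<Rightarrow> real"
  assume "n < m" and \<psi>: "\<psi> \<in> test_functions \<Omega>"
  let ?d = "\<lambda>i j x. frechet_derivative \<phi> (at x) (axis i 1) $ j"
  let ?e = "\<lambda>i x. frechet_derivative \<psi> (at x) (axis i 1)"
  have Cd: "Cc (?d i j)" for i j
    by (rule Cc_linear_image[OF Cc_frechet_derivative[OF \<phi>] linear_vec_nth])
  have C\<phi>: "Cc (\<lambda>x. \<phi> x $ j)" for j
    by (rule Cc_linear_image[OF Cc_test_function[OF \<phi>] linear_vec_nth])
  note C\<psi> = Cc_test_function[OF \<psi>] and Ce = Cc_frechet_derivative[OF \<psi>]
  have parts: "(\<integral>x. ?d i j x * \<psi> x \<partial>lborel) = - (\<integral>x. \<phi> x $ j * ?e i x \<partial>lborel)" for i j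
    by (rule integral_by_parts_dir_derivative[OF C\<phi> Cd has_dir_derivative_test_function_component[OF \<phi>]
          C\<psi> Ce has_dir_derivative_frechet[OF has_derivative_test_function[OF \<psi>]]])
  have "(\<integral>x. classical_curl \<phi> x $ n $ m * \<psi> x \<partial>lebesgue_on \<Omega>)
      = (\<integral>x. classical_curl \<phi> x $ n $ m * \<psi> x \<partial>lborel)"
    by (intro integral_lebesgue_on_Cc Cc_mult C\<psi> \<Omega>
        Cc_linear_image[OF Cc_linear_image[OF Cc_classical_curl[OF \<phi>] linear_vec_nth] linear_vec_nth])
      (simp add: test_function_eq_0_outside[OF \<psi>])
  also have "\<dots> = (\<integral>x. ?d n m x * \<psi> x - ?d m n x * \<psi> x \<partial>lborel)"
    using \<open>n < m\<close> by (simp add: classical_curl_def left_diff_distrib)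
  also have "\<dots> = - (\<integral>x. \<phi> x $ m * ?e n x - \<phi> x $ n * ?e m x \<partial>lborel)"
    using Cc_mult[OF Cd C\<psi>, THEN Cc_integrable] Cc_mult[OF C\<phi> Ce, THEN Cc_integrable]
    by (simp add: parts)
  also have "\<dots> = - (\<integral>x. \<phi> x $ m * ?e n x - \<phi> x $ n * ?e m x \<partial>lebesgue_on \<Omega>)"
    by (subst integral_lebesgue_on_Cc)
      (auto intro!: Cc_diff Cc_mult C\<phi> Ce \<Omega> simp: frechet_derivative_eq_0_outside[OF \<psi>])
  finally show "(\<integral>x. classical_curl \<phi> x $ n $ m * \<psi> x \<partial>lebesgue_on \<Omega>)
      = - (\<integral>x. \<phi> x $ m * ?e n x - \<phi> x $ n * ?e m x \<partial>lebesgue_on \<Omega>)" .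
qed (simp add: classical_curl_def)

section \<open>Integration over segments\<close>
definition line_average :: "real \<Rightarrow> 'a::euclidean_space \<Rightarrow> ('a \<Rightarrow> real) \<Rightarrow> 'a \<Rightarrow> real" where
  "line_average L e f x = integral {0..L} (\<lambda>t. f (x - t *\<^sub>R e))"

lemma line_integrable:
  assumes "Cc f"
  shows "(\<lambda>t. f (x - t *\<^sub>R e)) integrable_on {0..L}"
proof (rule integrable_continuous_real)
  show "continuous_on {0..L} (\<lambda>t. f (x - t *\<^sub>R e))"
    using Cc_continuous[OF assms, of UNIV]
    by (rule continuous_on_compose2) (auto intro!: continuous_intros)
qed

lemma line_average_add:
  assumes "Cc f" "Cc g"
  shows "line_average L e (\<lambda>x. f x + g x) x = line_average L e f x + line_average L e g x"
  unfolding line_average_def by (intro Henstock_Kurzweil_Integration.integral_add line_integrable assms)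

lemma line_average_eq_0:
  assumes "0 \<le> L" "\<And>x. R < norm x \<Longrightarrow> f x = 0" "R + L * norm e < norm x"
  shows "line_average L e f x = 0"
proof -
  have "f (x - t *\<^sub>R e) = 0" if "t \<in> {0..L}" for t
  proof (rule assms(2))
    have "norm (t *\<^sub>R e) \<le> L * norm e"
      using that by (simp add: mult_right_mono)
    moreover have "norm x \<le> norm (x - t *\<^sub>R e) + norm (t *\<^sub>R e)"
      by (metis diff_add_cancel norm_triangle_ineq)
    ultimately show "R < norm (x - t *\<^sub>R e)"
      using assms(3) by linarith
  qed
  then show ?thesis
    unfolding line_average_def by (intro integral_unique has_integral_is_0)
qed

lemma continuous_shear:
  fixes f :: "'a::euclidean_space \<Rightarrow> 'b::euclidean_space"
  assumes "continuous_on UNIV f"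
  shows "continuous_on S (\<lambda>(x, t). f (x - t *\<^sub>R e))"
  unfolding split_beta
  by (rule continuous_on_compose2[OF assms]) (auto intro!: continuous_intros)

lemma Cc_line_average:
  assumes "Cc f" "0 \<le> L"
  shows "Cc (line_average L e f)"
proof -
  obtain K R where R: "\<And>x. R < norm x \<Longrightarrow> f x = 0"
    using Cc_bounds[OF assms(1)] by metis
  show ?thesis
  proof (rule CcI)
    show "continuous_on UNIV (line_average L e f)"
      unfolding line_average_def[abs_def] cbox_interval[symmetric]
      by (rule integral_continuous_on_param[OF continuous_shear[OF Cc_continuous[OF assms(1)]]])
    show "{x. line_average L e f x \<noteq> 0} \<subseteq> cball 0 (R + L * norm e)"
    proof
      fix x assume "x \<in> {x. line_average L e f x \<noteq> 0}"
      then have "\<not> R + L * norm e < norm x"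
        using line_average_eq_0[of L R f e x, OF assms(2) R] by blast
      then show "x \<in> cball 0 (R + L * norm e)" by simp
    qed
  qed simp
qed

text \<open>Fubini's theorem: every translate of \<open>f\<close> has the same integral.  A box that contains the supports of
all translates makes the swap of continuous integrands over boxes applicable.\<close>
lemma integral_line_average:
  fixes f :: "'a::euclidean_space \<Rightarrow> real"
  assumes f: "Cc f" and L: "0 \<le> L"
  shows "(\<integral>x. line_average L e f x \<partial>lborel) = L * (\<integral>x. f x \<partial>lborel)"
proof -
  obtain K R where R: "\<And>x. R < norm x \<Longrightarrow> f x = 0"
    using Cc_bounds[OF f] by metis
  define R' where "R' = R + L * norm e"
  obtain a where a: "cball 0 R' \<subseteq> cbox (- a) (a :: 'a)"
    using bounded_subset_cbox_symmetric[OF bounded_cball] by blast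
  have out: "R' < norm x" if "x \<notin> cbox (- a) a" for x
    using a that by (force simp: not_le)
  have box: "integral (cbox (- a) a) g = (\<integral>x. g x \<partial>lborel)"
    if g: "Cc g" "\<And>x. R' < norm x \<Longrightarrow> g x = 0" for g :: "'a \<Rightarrow> real"
  proof -
    have "(\<lambda>x. if x \<in> cbox (- a) a then g x else 0) = g"
      using g(2) out by fastforce
    then have "integral (cbox (- a) a) g = integral UNIV g"
      by (metis integral_restrict_UNIV)
    then show ?thesis
      using integral_lborel[OF Cc_integrable[OF g(1)]] by simp
  qed
  have "(\<integral>x. line_average L e f x \<partial>lborel) = integral (cbox (- a) a) (line_average L e f)"
    using line_average_eq_0[OF L R] by (intro box[symmetric] Cc_line_average f L) (auto simp: R'_def)
  also have "\<dots> = integral (cbox 0 L) (\<lambda>t. integral (cbox (- a) a) (\<lambda>x. f (x - t *\<^sub>R e)))"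
    unfolding line_average_def[abs_def] cbox_interval[symmetric]
    by (rule integral_swap_continuous[OF continuous_shear[OF Cc_continuous[OF f]]])
  also have "\<dots> = integral (cbox 0 L) (\<lambda>t. \<integral>x. f x \<partial>lborel)"
  proof (rule integral_cong)
    fix t assume t: "t \<in> cbox 0 L"
    have "integral (cbox (- a) a) (\<lambda>x. f (x - t *\<^sub>R e)) = (\<integral>x. f (x - t *\<^sub>R e) \<partial>lborel)"
    proof (rule box)
      show "Cc (\<lambda>x. f (x - t *\<^sub>R e))"
        using Cc_translate[OF f, of "- t *\<^sub>R e"] by simp
      show "f (x - t *\<^sub>R e) = 0" if "R' < norm x" for x
      proof (rule R)
        have "norm (t *\<^sub>R e) \<le> L * norm e"
          using t by (simp add: mult_right_mono)
        moreover have "norm x \<le> norm (x - t *\<^sub>R e) + norm (t *\<^sub>R e)"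
          by (metis diff_add_cancel norm_triangle_ineq)
        ultimately show "R < norm (x - t *\<^sub>R e)"
          using that unfolding R'_def by linarith
      qed
    qed
    then show "integral (cbox (- a) a) (\<lambda>x. f (x - t *\<^sub>R e)) = (\<integral>x. f x \<partial>lborel)"
      using integral_translate[OF Cc_measurable[OF f], of "- t *\<^sub>R e"] by simp
  qed
  also have "\<dots> = L * (\<integral>x. f x \<partial>lborel)"
    using L by simp
  finally show ?thesis .
qed

text \<open>The Cauchy-Schwarz inequality on \<open>[0, L]\<close>, from the nonnegativity of the integral of \<open>(h - c)\<^sup>2\<close> at the
mean value \<open>c = A / L\<close>.\<close>
lemma line_average_power2_le:
  assumes f: "Cc f" and L: "0 \<le> L"
  shows "(line_average L e f x)\<^sup>2 \<le> L * line_average L e (\<lambda>x. (f x)\<^sup>2) x"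
proof -
  define h where "h t = f (x - t *\<^sub>R e)" for t
  define A where "A = integral {0..L} h"
  have f2: "Cc (\<lambda>x. (f x)\<^sup>2)"
    using Cc_norm_power2[OF f] by simp
  have int: "h integrable_on {0..L}" "(\<lambda>t. (h t)\<^sup>2) integrable_on {0..L}"
    unfolding h_def by (rule line_integrable[OF f], rule line_integrable[OF f2])
  have quad: "0 \<le> integral {0..L} (\<lambda>t. (h t)\<^sup>2) - 2 * c * A + c\<^sup>2 * L" for c
  proof -
    have "((\<lambda>t. (h t)\<^sup>2 - 2 * c * h t + c\<^sup>2) has_integral
        (integral {0..L} (\<lambda>t. (h t)\<^sup>2) - 2 * c * A + c\<^sup>2 * L)) {0..L}"
      using has_integral_const_real[of "c\<^sup>2" 0 L] L unfolding A_def
      by (intro has_integral_add has_integral_diff has_integral_mult_right integrable_integral int)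
        (simp add: mult.commute)
    moreover have "0 \<le> (h t)\<^sup>2 - 2 * c * h t + c\<^sup>2" for t
      using zero_le_power2[of "h t - c"] by (simp add: power2_diff algebra_simps)
    ultimately show ?thesis
      by (rule has_integral_nonneg) 
  qed
  have "A\<^sup>2 \<le> L * integral {0..L} (\<lambda>t. (h t)\<^sup>2)"
  proof (cases "L = 0")
    case True
    then show ?thesis by (simp add: A_def)
  next
    case False
    with L quad[of "A / L"] show ?thesis
      by (simp add: power2_eq_square field_simps)
  qed
  then show ?thesis
    by (simp add: A_def h_def[abs_def] line_average_def)
qed

lemma L2_norm_line_average_le:
  assumes f: "Cc f" and L: "0 \<le> L"
  shows "L2_norm UNIV (line_average L e f) \<le> L * L2_norm UNIV f"
proof (rule power2_le_imp_le)
  have f2: "Cc (\<lambda>x. (f x)\<^sup>2)"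
    using Cc_norm_power2[OF f] by simp
  have "(L2_norm UNIV (line_average L e f))\<^sup>2 = (\<integral>x. (line_average L e f x)\<^sup>2 \<partial>lborel)"
    using L2_norm_UNIV[OF Cc_line_average[OF f L], of e] by simp
  also have "\<dots> \<le> (\<integral>x. L * line_average L e (\<lambda>x. (f x)\<^sup>2) x \<partial>lborel)"
    using Cc_integrable[OF Cc_norm_power2[OF Cc_line_average[OF f L, of e]]]
      Cc_integrable[OF Cc_line_average[OF f2 L, of e]]
    by (intro integral_mono line_average_power2_le f L) auto
  also have "\<dots> = L\<^sup>2 * (\<integral>x. (f x)\<^sup>2 \<partial>lborel)"
    using integral_line_average[OF f2 L, of e] by (simp add: power2_eq_square)
  also have "\<dots> = (L * L2_norm UNIV f)\<^sup>2"
    using L2_norm_UNIV[OF f] by (simp add: power_mult_distrib)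
  finally show "(L2_norm UNIV (line_average L e f))\<^sup>2 \<le> (L * L2_norm UNIV f)\<^sup>2" .
qed (simp add: L L2_norm_nonneg)

lemma has_dir_derivative_line_average:
  assumes "has_dir_derivative f a g" "Cc f" "Cc g"
  shows "has_dir_derivative (line_average L e f) a (line_average L e g)"
  unfolding has_dir_derivative_def
proof
  fix x
  have "((\<lambda>s. integral (cbox 0 L) (\<lambda>t. f (x + s *\<^sub>R a - t *\<^sub>R e))) has_vector_derivative
      integral (cbox 0 L) (\<lambda>t. g (x + 0 *\<^sub>R a - t *\<^sub>R e))) (at 0 within UNIV)"
  proof (rule leibniz_rule_vector_derivative)
    fix s t :: real
    have "((\<lambda>s. f (x - t *\<^sub>R e + s *\<^sub>R a)) has_real_derivative g (x - t *\<^sub>R e + s *\<^sub>R a)) (at s)"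
      by (rule has_dir_derivativeD[OF assms(1)])
    then show "((\<lambda>s. f (x + s *\<^sub>R a - t *\<^sub>R e)) has_vector_derivative g (x + s *\<^sub>R a - t *\<^sub>R e))
        (at s within UNIV)"
      by (simp add: has_real_derivative_iff_has_vector_derivative algebra_simps)
  next
    show "continuous_on (UNIV \<times> cbox 0 L) (\<lambda>(s, t). g (x + s *\<^sub>R a - t *\<^sub>R e))"
      unfolding split_beta
      by (rule continuous_on_compose2[OF Cc_continuous[OF assms(3), of UNIV]])
        (auto intro!: continuous_intros)
  qed (use line_integrable[OF assms(2)] in auto)
  then show "((\<lambda>t. line_average L e f (x + t *\<^sub>R a)) has_real_derivative line_average L e g x) (at 0)"
    by (simp add: has_real_derivative_iff_has_vector_derivative line_average_def)
qed

text \<open>The fundamental theorem of calculus along the segment.\<close>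
lemma line_average_dir_derivative:
  assumes "has_dir_derivative f e g" "0 \<le> L"
  shows "line_average L e g x = f x - f (x - L *\<^sub>R e)"
proof -
  have "((\<lambda>t. - f (x - t *\<^sub>R e)) has_vector_derivative g (x - t *\<^sub>R e)) (at t within {0..L})" for t
  proof -
    have "((\<lambda>t. f (x + t *\<^sub>R e)) has_real_derivative g (x + (- t) *\<^sub>R e)) (at (- t))"
      by (rule has_dir_derivativeD[OF assms(1)])
    moreover have "(uminus has_real_derivative -1) (at t)"
      by (auto intro!: derivative_eq_intros)
    ultimately have "((\<lambda>t. f (x + (- t) *\<^sub>R e)) has_real_derivative g (x + (- t) *\<^sub>R e) * -1) (at t)"
      by (rule DERIV_chain2)
    then have "((\<lambda>t. - f (x - t *\<^sub>R e)) has_real_derivative g (x - t *\<^sub>R e)) (at t)"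
      using DERIV_minus by fastforce
    then show ?thesis
      using has_field_derivative_at_within has_real_derivative_iff_has_vector_derivative by blast
  qed
  then have "((\<lambda>t. g (x - t *\<^sub>R e)) has_integral (- f (x - L *\<^sub>R e) - - f (x - 0 *\<^sub>R e))) {0..L}"
    by (intro fundamental_theorem_of_calculus assms(2))
  then show ?thesis
    unfolding line_average_def by (simp add: integral_unique)
qed

section \<open>The Korn inequality on the whole space\<close>
lemma power2_norm_matrix: "(norm (A :: real^'n^'m))\<^sup>2 = (\<Sum>i\<in>UNIV. \<Sum>j\<in>UNIV. (A $ i $ j)\<^sup>2)"
  by (simp add: norm_vec_def L2_set_def sum_nonneg)

text \<open>The cross terms are what the Korn inequality has to control.\<close>
lemma power2_norm_sym_part:
  "2 * (norm (sym_part A))\<^sup>2 = (norm A)\<^sup>2 + (\<Sum>i\<in>UNIV. \<Sum>j\<in>UNIV. A $ i $ j * A $ j $ i)"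
proof -
  have swap: "(\<Sum>i\<in>UNIV. \<Sum>j\<in>UNIV. (A $ j $ i)\<^sup>2) = (\<Sum>i\<in>UNIV. \<Sum>j\<in>UNIV. (A $ i $ j)\<^sup>2)"
    by (rule sum.swap)
  have "2 * (norm (sym_part A))\<^sup>2
      = (\<Sum>i\<in>UNIV. \<Sum>j\<in>UNIV. (A $ i $ j)\<^sup>2 / 2 + (A $ j $ i)\<^sup>2 / 2 + A $ i $ j * A $ j $ i)"
    unfolding power2_norm_matrix sum_distrib_left
    by (intro sum.cong refl) (simp add: sym_part_def transpose_def power2_eq_square field_simps)
  also have "\<dots> = (norm A)\<^sup>2 + (\<Sum>i\<in>UNIV. \<Sum>j\<in>UNIV. A $ i $ j * A $ j $ i)"
    unfolding power2_norm_matrix sum.distrib sum_divide_distrib[symmetric] swap by simp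
  finally show ?thesis .
qed

lemma linear_sym_part: "linear (sym_part :: real^'n^'n \<Rightarrow> real^'n^'n)"
  by (rule linearI) (auto simp: sym_part_def transpose_def vec_eq_iff algebra_simps)

lemma norm_sym_part_le: "norm (sym_part A) \<le> norm A"
proof -
  have "norm (transpose A) = norm A"
  proof -
    have "(norm (transpose A))\<^sup>2 = (norm A)\<^sup>2"
      unfolding power2_norm_matrix transpose_def using sum.swap by simp
    then show ?thesis by simp
  qed
  then have "norm (A + transpose A) \<le> 2 * norm A"
    using norm_triangle_ineq[of A "transpose A"] by simp
  then show ?thesis by (simp add: sym_part_def)
qed

text \<open>Exchanging the two derivatives turns the cross terms \<open>\<partial>\<^sub>m u\<^sub>n \<partial>\<^sub>n u\<^sub>m\<close> into \<open>\<partial>\<^sub>n u\<^sub>n \<partial>\<^sub>m u\<^sub>m\<close>, whose sum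
is the square of the divergence and hence has a nonnegative integral.\<close>
theorem Korn_first_inequality:
  fixes u :: "'n::finite \<Rightarrow> real^'n \<Rightarrow> real" and G :: "real^'n \<Rightarrow> real^'n^'n"
  assumes u: "\<And>n. Cc (u n)" and G: "Cc G"
    and grad: "\<And>n m. has_dir_derivative (u n) (axis m 1) (\<lambda>x. G x $ n $ m)"
  shows "L2_norm UNIV G \<le> sqrt 2 * L2_norm UNIV (\<lambda>x. sym_part (G x))"
proof -
  have G': "Cc (\<lambda>x. G x $ n $ m)" for n m
    by (rule Cc_linear_image[OF Cc_linear_image[OF G linear_vec_nth] linear_vec_nth])
  note int = Cc_integrable[OF Cc_mult[OF G' G']]
  have "(\<integral>x. (\<Sum>n\<in>UNIV. \<Sum>m\<in>UNIV. G x $ n $ m * G x $ m $ n) \<partial>lborel)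
      = (\<Sum>n\<in>UNIV. \<Sum>m\<in>UNIV. \<integral>x. G x $ n $ m * G x $ m $ n \<partial>lborel)"
    using int by simp
  also have "\<dots> = (\<Sum>n\<in>UNIV. \<Sum>m\<in>UNIV. \<integral>x. G x $ n $ n * G x $ m $ m \<partial>lborel)"
    by (intro sum.cong refl integral_dir_derivatives_swap[OF u G' G' grad grad u G' G' grad grad])
  also have "\<dots> = (\<integral>x. (\<Sum>n\<in>UNIV. \<Sum>m\<in>UNIV. G x $ n $ n * G x $ m $ m) \<partial>lborel)"
    using int by simp
  also have "\<dots> = (\<integral>x. (\<Sum>n\<in>UNIV. G x $ n $ n)\<^sup>2 \<partial>lborel)"
    by (simp add: power2_eq_square sum_product)
  finally have cross: "0 \<le> (\<integral>x. (\<Sum>n\<in>UNIV. \<Sum>m\<in>UNIV. G x $ n $ m * G x $ m $ n) \<partial>lborel)"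
    by simp
  have "2 * (L2_norm UNIV (\<lambda>x. sym_part (G x)))\<^sup>2
      = (\<integral>x. 2 * (norm (sym_part (G x)))\<^sup>2 \<partial>lborel)"
    unfolding L2_norm_UNIV[OF Cc_linear_image[OF G linear_sym_part]] by simp
  also have "\<dots> = (L2_norm UNIV G)\<^sup>2 + (\<integral>x. (\<Sum>n\<in>UNIV. \<Sum>m\<in>UNIV. G x $ n $ m * G x $ m $ n) \<partial>lborel)"
    unfolding power2_norm_sym_part L2_norm_UNIV[OF G]
    using int Cc_integrable[OF Cc_norm_power2[OF G]]
    by (intro Bochner_Integration.integral_add Bochner_Integration.integrable_sum) auto
  finally have "(L2_norm UNIV G)\<^sup>2 \<le> (sqrt 2 * L2_norm UNIV (\<lambda>x. sym_part (G x)))\<^sup>2"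
    using cross by (simp add: power_mult_distrib)
  then show ?thesis
    by (rule power2_le_imp_le) (simp add: L2_norm_nonneg)
qed

section \<open>The estimate for test fields\<close>
lemma row_eq_nth: "row n A = A $ n"
  by (simp add: row_def vec_eq_iff)

definition classical_Curl ::
    "(('n::{finite,linorder}) rvec \<Rightarrow> 'n rmat) \<Rightarrow> 'n rvec \<Rightarrow> ('n rmat, 'n) vec" where
  "classical_Curl \<Phi> x = (\<chi> n. classical_curl (\<lambda>y. row n (\<Phi> y)) x)"

text \<open>In the notation of the proof, \<open>G = \<nabla>u = F + Q\<close>, where \<open>u\<close> averages the \<open>k\<close>-th column of \<open>\<Phi>\<close> over
segments in the direction \<open>e\<close>, \<open>F\<close> is the difference of \<open>\<Phi>\<close> and its translate by \<open>L e\<close>, and \<open>Q\<close> is the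
segment average of curl entries.\<close>
theorem Korn_Curl_test_fields:
  fixes \<Omega> :: "(('n::{finite,linorder}) rvec) set"
  assumes \<Omega>: "open \<Omega>" "bounded \<Omega>"
  obtains C where "0 \<le> C"
    and "\<And>\<Phi>. (\<And>n. (\<lambda>x. row n (\<Phi> x)) \<in> test_functions \<Omega>) \<Longrightarrow>
      L2_norm \<Omega> \<Phi> \<le> C * (L2_norm \<Omega> (\<lambda>x. sym_part (\<Phi> x)) + L2_norm \<Omega> (classical_Curl \<Phi>))"
proof -
  obtain B where B: "0 < B" "\<And>x. x \<in> \<Omega> \<Longrightarrow> norm x \<le> B"
    using \<Omega>(2) unfolding bounded_pos by blast
  \<comment> \<open>Two points of \<open>\<Omega>\<close> have distance at most \<open>2 * B\<close>, so translation by \<open>L\<close> moves \<open>\<Omega>\<close> off itself.\<close>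
  define L where "L = 2 * B + 1"
  have L: "0 \<le> L" using B(1) by (simp add: L_def)
  \<comment> \<open>Any coordinate direction serves.\<close>
  define k :: 'n where "k = undefined"
  define e :: "'n rvec" where "e = axis k 1"
  define N where "N = real CARD('n)"
  define C where "C = 2 * sqrt 2 + (sqrt 2 + 1) * (N * L)"
  have C: "0 \<le> C" using L by (simp add: C_def N_def)
  show thesis
  proof (rule that[OF C])
    fix \<Phi> :: "'n rvec \<Rightarrow> 'n rmat"
    assume test: "\<And>n. (\<lambda>x. row n (\<Phi> x)) \<in> test_functions \<Omega>"
    \<comment> \<open>\<open>d n i j\<close> is the derivative of the entry \<open>(n, j)\<close> in the direction \<open>i\<close>.\<close>
    define d where "d n i j x = frechet_derivative (\<lambda>x. row n (\<Phi> x)) (at x) (axis i 1) $ j" for n i j x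
    define c where "c n m x = d n m k x - d n k m x" for n m x
    define Q where "Q x = (\<chi> n m. line_average L e (c n m) x)" for x
    define G where "G x = (\<chi> n m. line_average L e (d n m k) x)" for x
    define F where "F x = \<Phi> x - \<Phi> (x + (- L *\<^sub>R e))" for x
    have C\<Phi>: "Cc \<Phi>"
      by (rule Cc_vec) (use Cc_test_function[OF test] in \<open>simp add: row_eq_nth\<close>)
    have C\<Phi>_comp: "Cc (\<lambda>x. \<Phi> x $ n $ m)" for n m
      by (rule Cc_linear_image[OF Cc_linear_image[OF C\<Phi> linear_vec_nth] linear_vec_nth])
    have Cd: "Cc (d n i j)" for n i j
      unfolding d_def by (rule Cc_linear_image[OF Cc_frechet_derivative[OF test] linear_vec_nth])
    have Cc_c: "Cc (c n m)" for n m
      unfolding c_def by (intro Cc_diff Cd)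
    have dd: "has_dir_derivative (\<lambda>x. \<Phi> x $ n $ j) (axis i 1) (d n i j)" for n i j
      using has_dir_derivative_test_function_component[OF test, of n j "axis i 1"]
      by (simp add: row_eq_nth d_def[abs_def])
    have CQ: "Cc Q"
      unfolding Q_def by (intro Cc_vec) (simp add: Cc_line_average Cc_c L)
    have CG: "Cc G"
      unfolding G_def by (intro Cc_vec) (simp add: Cc_line_average Cd L)
    have C\<tau>: "Cc (\<lambda>x. \<Phi> (x + (- L *\<^sub>R e)))"
      by (rule Cc_translate[OF C\<Phi>])
    have CF: "Cc F"
      unfolding F_def by (intro Cc_diff C\<Phi> C\<tau>)
    have Csym: "Cc (\<lambda>x. sym_part (f x))" if "Cc f" for f :: "'n rvec \<Rightarrow> 'n rmat"
      by (rule Cc_linear_image[OF that linear_sym_part])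
    note L2I = Cc_L2[OF _ open_UNIV]
    have G_eq: "G x = F x + Q x" for x
    proof -
      have "G x $ n $ m = F x $ n $ m + Q x $ n $ m" for n m
      proof -
        have "line_average L e (d n m k) x = line_average L e (\<lambda>x. c n m x + d n k m x) x"
          by (simp add: c_def)
        also have "\<dots> = line_average L e (c n m) x + line_average L e (d n k m) x"
          by (rule line_average_add[OF Cc_c Cd])
        also have "line_average L e (d n k m) x = \<Phi> x $ n $ m - \<Phi> (x - L *\<^sub>R e) $ n $ m"
          unfolding e_def by (rule line_average_dir_derivative[OF dd L])
        finally show ?thesis by (simp add: G_def F_def Q_def)
      qed
      then show ?thesis by (simp add: vec_eq_iff)
    qed
    have Korn: "L2_norm UNIV G \<le> sqrt 2 * L2_norm UNIV (\<lambda>x. sym_part (G x))"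
    proof (rule Korn_first_inequality[OF Cc_line_average[OF C\<Phi>_comp L] CG])
      show "has_dir_derivative (line_average L e (\<lambda>x. \<Phi> x $ n $ k)) (axis m 1) (\<lambda>x. G x $ n $ m)" for n m
        using has_dir_derivative_line_average[OF dd C\<Phi>_comp Cd, of L e n k m] by (simp add: G_def)
    qed
    have out: "\<Phi> x = 0" if "x \<notin> \<Omega>" for x
      using test_function_eq_0_outside[OF test that] by (simp add: vec_eq_iff row_eq_nth)
    \<comment> \<open>Where \<open>\<Phi>\<close> is nonzero its translate vanishes, so \<open>\<Phi> = F\<close> there.\<close>
    have "L2_norm UNIV \<Phi> \<le> 1 * L2_norm UNIV F"
    proof (rule L2_norm_mono[OF L2I[OF C\<Phi>] L2I[OF CF]])
      fix x :: "'n rvec"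
      show "norm (\<Phi> x) \<le> 1 * norm (F x)"
      proof (cases "x \<in> \<Omega>")
        case True
        have "norm (L *\<^sub>R e) = L" using L by (simp add: e_def)
        moreover have "norm (L *\<^sub>R e) \<le> norm x + norm (x - L *\<^sub>R e)"
          using norm_triangle_ineq4[of x "x - L *\<^sub>R e"] by simp
        ultimately have "B < norm (x - L *\<^sub>R e)"
          using B(1) B(2)[OF True] unfolding L_def by linarith
        then have "x - L *\<^sub>R e \<notin> \<Omega>"
          using B(2) by force
        then show ?thesis by (simp add: F_def out)
      qed (simp add: out)
    qed simp
    also have "1 * L2_norm UNIV F = L2_norm UNIV (\<lambda>x. G x + (-1) *\<^sub>R Q x)"
      by (simp add: G_eq)
    also have "\<dots> \<le> L2_norm UNIV G + L2_norm UNIV (\<lambda>x. (-1) *\<^sub>R Q x)"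
      by (intro L2_norm_triangle L2_scaleR L2I CG CQ)
    also have "L2_norm UNIV (\<lambda>x. (-1) *\<^sub>R Q x) = L2_norm UNIV Q"
      unfolding L2_norm_scaleR by simp
    finally have 1: "L2_norm UNIV \<Phi> \<le> L2_norm UNIV G + L2_norm UNIV Q" by simp
    have "L2_norm UNIV (\<lambda>x. sym_part (G x)) = L2_norm UNIV (\<lambda>x. sym_part (F x) + sym_part (Q x))"
      unfolding G_eq using linear_add[OF linear_sym_part] by metis
    also have "\<dots> \<le> L2_norm UNIV (\<lambda>x. sym_part (F x)) + L2_norm UNIV (\<lambda>x. sym_part (Q x))"
      by (intro L2_norm_triangle L2I Csym CF CQ)
    also have "L2_norm UNIV (\<lambda>x. sym_part (Q x)) \<le> 1 * L2_norm UNIV Q"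
      by (rule L2_norm_mono) (auto intro!: L2I Csym CQ norm_sym_part_le)
    also have "L2_norm UNIV (\<lambda>x. sym_part (F x))
        = L2_norm UNIV (\<lambda>x. sym_part (\<Phi> x) + (-1) *\<^sub>R sym_part (\<Phi> (x + (- L *\<^sub>R e))))"
      unfolding F_def by (simp add: linear_diff[OF linear_sym_part])
    also have "\<dots> \<le> L2_norm UNIV (\<lambda>x. sym_part (\<Phi> x))
        + L2_norm UNIV (\<lambda>x. (-1) *\<^sub>R sym_part (\<Phi> (x + (- L *\<^sub>R e))))"
      by (intro L2_norm_triangle L2_scaleR L2I Csym C\<Phi> C\<tau>)
    also have "L2_norm UNIV (\<lambda>x. (-1) *\<^sub>R sym_part (\<Phi> (x + (- L *\<^sub>R e))))
        = L2_norm UNIV (\<lambda>x. sym_part (\<Phi> x))"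
    proof -
      have "(L2_norm UNIV (\<lambda>x. sym_part (\<Phi> (x + (- L *\<^sub>R e)))))\<^sup>2 = (L2_norm UNIV (\<lambda>x. sym_part (\<Phi> x)))\<^sup>2"
        unfolding L2_norm_UNIV[OF Csym[OF C\<tau>]] L2_norm_UNIV[OF Csym[OF C\<Phi>]]
        by (rule integral_translate[OF Cc_measurable[OF Cc_norm_power2[OF Csym[OF C\<Phi>]]]])
      then show ?thesis
        unfolding L2_norm_scaleR by (simp add: L2_norm_nonneg)
    qed
    finally have 2: "L2_norm UNIV (\<lambda>x. sym_part (G x))
        \<le> 2 * L2_norm UNIV (\<lambda>x. sym_part (\<Phi> x)) + L2_norm UNIV Q"
      by simp
    have C_Curl: "Cc (classical_Curl \<Phi>)"
      unfolding classical_Curl_def[abs_def] by (rule Cc_vec) (simp add: Cc_classical_curl[OF test])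
    have "(L2_norm UNIV Q)\<^sup>2 = (\<Sum>n\<in>UNIV. \<Sum>m\<in>UNIV. (L2_norm UNIV (\<lambda>x. Q x $ n $ m))\<^sup>2)"
      unfolding L2_norm_vec[OF L2I[OF CQ]]
      by (intro sum.cong refl L2_norm_vec L2I Cc_linear_image[OF CQ linear_vec_nth])
    also have "\<dots> \<le> (\<Sum>n\<in>(UNIV::'n set). \<Sum>m\<in>(UNIV::'n set). (L * L2_norm UNIV (classical_Curl \<Phi>))\<^sup>2)"
    proof (intro sum_mono power_mono)
      fix n m
      have "L2_norm UNIV (\<lambda>x. Q x $ n $ m) \<le> L * L2_norm UNIV (c n m)"
        using L2_norm_line_average_le[OF Cc_c L, of e n m] by (simp add: Q_def)
      also have "L2_norm UNIV (c n m) \<le> 1 * L2_norm UNIV (classical_Curl \<Phi>)"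
      proof (rule L2_norm_mono[OF L2I[OF Cc_c] L2I[OF C_Curl]])
        fix x :: "'n rvec"
        have "\<exists>i j. norm (c n m x) = norm (classical_Curl \<Phi> x $ n $ i $ j)"
        proof (cases m k rule: linorder_cases)
          case less
          then show ?thesis
            by (intro exI[of _ m] exI[of _ k])
              (simp add: c_def d_def classical_Curl_def classical_curl_def)
        next
          case equal
          then show ?thesis
            by (intro exI[of _ m] exI[of _ m])
              (simp add: c_def d_def classical_Curl_def classical_curl_def)
        next
          case greater
          then show ?thesis
            by (intro exI[of _ k] exI[of _ m])
              (simp add: c_def d_def classical_Curl_def classical_curl_def)
        qed
        then obtain i j where "norm (c n m x) = norm (classical_Curl \<Phi> x $ n $ i $ j)" by blast
        also have "\<dots> \<le> norm (classical_Curl \<Phi> x)"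
          using Finite_Cartesian_Product.norm_nth_le order_trans by metis
        finally show "norm (c n m x) \<le> 1 * norm (classical_Curl \<Phi> x)" by simp
      qed simp
      finally show "L2_norm UNIV (\<lambda>x. Q x $ n $ m) \<le> L * L2_norm UNIV (classical_Curl \<Phi>)"
        using L by (simp add: mult_left_mono)
    qed (rule L2_norm_nonneg)
    also have "\<dots> = (N * L * L2_norm UNIV (classical_Curl \<Phi>))\<^sup>2"
      by (simp add: N_def power2_eq_square)
    finally have 3: "L2_norm UNIV Q \<le> N * L * L2_norm UNIV (classical_Curl \<Phi>)"
      by (rule power2_le_imp_le) (simp add: L N_def L2_norm_nonneg)
    have "L2_norm UNIV \<Phi> \<le> sqrt 2 * (2 * L2_norm UNIV (\<lambda>x. sym_part (\<Phi> x)) + L2_norm UNIV Q) + L2_norm UNIV Q"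
      using 1 order_trans[OF Korn mult_left_mono[OF 2]] by simp
    also have "\<dots> = 2 * sqrt 2 * L2_norm UNIV (\<lambda>x. sym_part (\<Phi> x)) + (sqrt 2 + 1) * L2_norm UNIV Q"
      by (simp add: algebra_simps)
    also have "\<dots> \<le> C * L2_norm UNIV (\<lambda>x. sym_part (\<Phi> x)) + C * L2_norm UNIV (classical_Curl \<Phi>)"
    proof (intro add_mono)
      show "2 * sqrt 2 * L2_norm UNIV (\<lambda>x. sym_part (\<Phi> x)) \<le> C * L2_norm UNIV (\<lambda>x. sym_part (\<Phi> x))"
        using L by (intro mult_right_mono L2_norm_nonneg) (simp add: C_def N_def)
      have "(sqrt 2 + 1) * L2_norm UNIV Q \<le> (sqrt 2 + 1) * (N * L * L2_norm UNIV (classical_Curl \<Phi>))"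
        by (intro mult_left_mono 3) simp
      also have "\<dots> = (sqrt 2 + 1) * (N * L) * L2_norm UNIV (classical_Curl \<Phi>)"
        by simp
      also have "\<dots> \<le> C * L2_norm UNIV (classical_Curl \<Phi>)"
        by (intro mult_right_mono L2_norm_nonneg) (simp add: C_def)
      finally show "(sqrt 2 + 1) * L2_norm UNIV Q \<le> C * L2_norm UNIV (classical_Curl \<Phi>)" .
    qed
    finally have "L2_norm UNIV \<Phi> \<le> C * (L2_norm UNIV (\<lambda>x. sym_part (\<Phi> x)) + L2_norm UNIV (classical_Curl \<Phi>))"
      by (simp add: algebra_simps)
    moreover have "classical_Curl \<Phi> x = 0" if "x \<notin> \<Omega>" for x
      using classical_curl_eq_0_outside[OF test that] by (simp add: classical_Curl_def vec_eq_iff)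
    moreover have "sym_part (\<Phi> x) = 0" if "x \<notin> \<Omega>" for x
      using out[OF that] linear_0[OF linear_sym_part] by simp
    ultimately show "L2_norm \<Omega> \<Phi> \<le> C * (L2_norm \<Omega> (\<lambda>x. sym_part (\<Phi> x)) + L2_norm \<Omega> (classical_Curl \<Phi>))"
      using L2_norm_eq_UNIV[OF \<Omega>(1) C\<Phi> out] L2_norm_eq_UNIV[OF \<Omega>(1) Csym[OF C\<Phi>]]
        L2_norm_eq_UNIV[OF \<Omega>(1) C_Curl] by simp
  qed
qed

section \<open>Uniqueness and linearity of the weak curl\<close>
lemma L2_mult_Cc_integrable:
  fixes f g :: "'a::euclidean_space \<Rightarrow> real"
  assumes "open \<Omega>" "f \<in> L2 \<Omega>" "Cc g"
  shows "integrable (lebesgue_on \<Omega>) (\<lambda>x. f x * g x)"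
proof (rule integrable_norm_cancel)
  have g: "g \<in> L2 \<Omega>" by (rule Cc_L2) fact+
  show "integrable (lebesgue_on \<Omega>) (\<lambda>x. norm (f x * g x))"
    using L2_mult_integrable[OF assms(2) g] by (simp add: abs_mult)
  show "(\<lambda>x. f x * g x) \<in> borel_measurable (lebesgue_on \<Omega>)"
    using assms(2) g by (intro borel_measurable_times L2_measurable)
qed

lemma L2_nth: "f \<in> L2 \<Omega> \<Longrightarrow> (\<lambda>x. f x $ i) \<in> L2 \<Omega>"
  for f :: "'a::euclidean_space \<Rightarrow> 'b::euclidean_space^'i::finite"
  by (rule L2_linear_image[OF _ linear_vec_nth])

lemma L2_integrable_bounded_domain:
  fixes f :: "'a::euclidean_space \<Rightarrow> real"
  assumes "open \<Omega>" "bounded \<Omega>" "f \<in> L2 \<Omega>"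
  shows "integrable (lebesgue_on \<Omega>) f"
proof (rule integrable_norm_cancel)
  have "emeasure lebesgue \<Omega> < \<infinity>"
    using emeasure_bounded_finite[OF assms(2)] assms(1) by simp
  then have "integrable (lebesgue_on \<Omega>) (\<lambda>x. 1 :: real)"
    using assms(1) unfolding integral_lebesgue_on(2)[OF assms(1)] by simp
  then have "(\<lambda>x. 1 :: real) \<in> L2 \<Omega>"
    by (simp add: L2_def)
  from L2_mult_integrable[OF assms(3) this] show "integrable (lebesgue_on \<Omega>) (\<lambda>x. norm (f x))"
    by simp
qed (rule L2_measurable[OF assms(3)])

lemma has_weak_curl_add:
  fixes v v' :: "('n::{finite,linorder}) rvec \<Rightarrow> 'n rvec"
  assumes \<Omega>: "open \<Omega>" and L2: "v \<in> L2 \<Omega>" "v' \<in> L2 \<Omega>" "w \<in> L2 \<Omega>" "w' \<in> L2 \<Omega>"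
    and wc: "has_weak_curl \<Omega> v w" "has_weak_curl \<Omega> v' w'"
  shows "has_weak_curl \<Omega> (\<lambda>x. v x + v' x) (\<lambda>x. w x + w' x)"
  unfolding has_weak_curl_def
proof (intro conjI allI impI ballI)
  fix n m :: 'n and \<phi> :: "'n rvec \<Rightarrow> real" assume nm: "n < m" and \<phi>: "\<phi> \<in> test_functions \<Omega>"
  let ?d = "\<lambda>i x. frechet_derivative \<phi> (at x) (axis i 1)"
  note int = L2_mult_Cc_integrable[OF \<Omega> _ Cc_test_function[OF \<phi>]]
    and dint = L2_mult_Cc_integrable[OF \<Omega> _ Cc_frechet_derivative[OF \<phi>]]
  have "(\<integral>x. (w x + w' x) $ n $ m * \<phi> x \<partial>lebesgue_on \<Omega>)
      = (\<integral>x. w x $ n $ m * \<phi> x \<partial>lebesgue_on \<Omega>) + (\<integral>x. w' x $ n $ m * \<phi> x \<partial>lebesgue_on \<Omega>)"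
    using int[OF L2_nth[OF L2_nth[OF L2(3)]], of n m] int[OF L2_nth[OF L2_nth[OF L2(4)]], of n m]
    by (simp add: distrib_right)
  also have "\<dots> = - (\<integral>x. v x $ m * ?d n x - v x $ n * ?d m x \<partial>lebesgue_on \<Omega>)
      + - (\<integral>x. v' x $ m * ?d n x - v' x $ n * ?d m x \<partial>lebesgue_on \<Omega>)"
    using wc nm \<phi> unfolding has_weak_curl_def by (metis (no_types, lifting))
  also have "\<dots> = - (\<integral>x. (v x + v' x) $ m * ?d n x - (v x + v' x) $ n * ?d m x \<partial>lebesgue_on \<Omega>)"
    using dint[OF L2_nth[OF L2(1)], of m] dint[OF L2_nth[OF L2(2)], of m]
      dint[OF L2_nth[OF L2(1)], of n] dint[OF L2_nth[OF L2(2)], of n]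
    by (simp add: distrib_right)
  finally show "(\<integral>x. (w x + w' x) $ n $ m * \<phi> x \<partial>lebesgue_on \<Omega>) = \<dots>" .
qed (use wc in \<open>simp add: has_weak_curl_def\<close>)

lemma has_weak_curl_scaleR:
  fixes v :: "('n::{finite,linorder}) rvec \<Rightarrow> 'n rvec"
  assumes "has_weak_curl \<Omega> v w"
  shows "has_weak_curl \<Omega> (\<lambda>x. c *\<^sub>R v x) (\<lambda>x. c *\<^sub>R w x)"
  unfolding has_weak_curl_def
proof (intro conjI allI impI ballI)
  fix n m :: 'n and \<phi> :: "'n rvec \<Rightarrow> real" assume nm: "n < m" and \<phi>: "\<phi> \<in> test_functions \<Omega>"
  let ?d = "\<lambda>i x. frechet_derivative \<phi> (at x) (axis i 1)"
  have "(\<integral>x. (c *\<^sub>R w x) $ n $ m * \<phi> x \<partial>lebesgue_on \<Omega>) = c * (\<integral>x. w x $ n $ m * \<phi> x \<partial>lebesgue_on \<Omega>)"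
    by (simp add: mult.assoc)
  also have "\<dots> = - (c * (\<integral>x. v x $ m * ?d n x - v x $ n * ?d m x \<partial>lebesgue_on \<Omega>))"
    using assms nm \<phi> unfolding has_weak_curl_def by simp
  also have "c * (\<integral>x. v x $ m * ?d n x - v x $ n * ?d m x \<partial>lebesgue_on \<Omega>)
      = (\<integral>x. c * (v x $ m * ?d n x - v x $ n * ?d m x) \<partial>lebesgue_on \<Omega>)"
    by (rule integral_mult_right_zero[symmetric])
  also have "\<dots> = (\<integral>x. (c *\<^sub>R v x) $ m * ?d n x - (c *\<^sub>R v x) $ n * ?d m x \<partial>lebesgue_on \<Omega>)"
    by (simp add: right_diff_distrib mult.assoc)
  finally show "(\<integral>x. (c *\<^sub>R w x) $ n $ m * \<phi> x \<partial>lebesgue_on \<Omega>)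
      = - (\<integral>x. (c *\<^sub>R v x) $ m * ?d n x - (c *\<^sub>R v x) $ n * ?d m x \<partial>lebesgue_on \<Omega>)" .
qed (use assms in \<open>simp add: has_weak_curl_def\<close>)

text \<open>The difference of the two curls is a weak curl of a null function, so each entry above the
diagonal integrates to zero against all test functions.\<close>
lemma weak_curl_unique:
  fixes v v' :: "('n::{finite,linorder}) rvec \<Rightarrow> 'n rvec"
  assumes \<Omega>: "open \<Omega>" "bounded \<Omega>"
    and L2: "v \<in> L2 \<Omega>" "v' \<in> L2 \<Omega>" "w \<in> L2 \<Omega>" "w' \<in> L2 \<Omega>"
    and wc: "has_weak_curl \<Omega> v w" "has_weak_curl \<Omega> v' w'"
    and eq: "AE x in lebesgue_on \<Omega>. v x = v' x"
  shows "AE x in lebesgue_on \<Omega>. w x = w' x"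
proof -
  let ?v = "\<lambda>x. v x + (-1) *\<^sub>R v' x" and ?w = "\<lambda>x. w x + (-1) *\<^sub>R w' x"
  have dwc: "has_weak_curl \<Omega> ?v ?w"
    by (intro has_weak_curl_add has_weak_curl_scaleR L2_scaleR L2 wc \<Omega>)
  have v0: "AE x in lebesgue_on \<Omega>. ?v x = 0"
    using eq by eventually_elim simp
  have v_L2: "?v \<in> L2 \<Omega>" and w_L2: "?w \<in> L2 \<Omega>"
    by (intro L2_add L2_scaleR L2)+
  have "AE x in lebesgue_on \<Omega>. ?w x $ n $ m = 0" for n m
  proof (cases "n < m")
    case True
    show ?thesis
    proof (rule fundamental_lemma_calculus_of_variations[OF \<Omega>(1)])
      show "integrable (lebesgue_on \<Omega>) (\<lambda>x. ?w x $ n $ m)"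
        by (intro L2_integrable_bounded_domain \<Omega> L2_nth w_L2)
      fix \<phi> :: "'n rvec \<Rightarrow> real" assume \<phi>: "\<phi> \<in> test_functions \<Omega>"
      let ?d = "\<lambda>i x. frechet_derivative \<phi> (at x) (axis i 1)"
      have "integrable (lebesgue_on \<Omega>) (\<lambda>x. ?v x $ m * ?d n x - ?v x $ n * ?d m x)"
        by (intro Bochner_Integration.integrable_diff L2_mult_Cc_integrable \<Omega> L2_nth v_L2
            Cc_frechet_derivative[OF \<phi>])
      then have "(\<integral>x. ?v x $ m * ?d n x - ?v x $ n * ?d m x \<partial>lebesgue_on \<Omega>)
          = (\<integral>x. 0 \<partial>lebesgue_on \<Omega>)"
        by (intro integral_cong_AE borel_measurable_integrable borel_measurable_const)
          (use v0 in \<open>auto elim!: eventually_mono simp: vec_eq_iff\<close>)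
      moreover have "(\<integral>x. ?w x $ n $ m * \<phi> x \<partial>lebesgue_on \<Omega>)
          = - (\<integral>x. ?v x $ m * ?d n x - ?v x $ n * ?d m x \<partial>lebesgue_on \<Omega>)"
        using dwc True \<phi> unfolding has_weak_curl_def by blast
      ultimately show "(\<integral>x. ?w x $ n $ m * \<phi> x \<partial>lebesgue_on \<Omega>) = 0"
        by simp
    qed
  next
    case False
    then have "\<forall>x\<in>\<Omega>. ?w x $ n $ m = 0"
      using dwc unfolding has_weak_curl_def by blast
    then show ?thesis by (intro AE_I2) simp
  qed
  then have "AE x in lebesgue_on \<Omega>. \<forall>n\<in>UNIV. \<forall>m\<in>UNIV. ?w x $ n $ m = 0"
    by (intro AE_finite_allI finite)
  then show ?thesis
    by eventually_elim (simp add: vec_eq_iff)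
qed

lemma curl_in_L2: "v \<in> H_curl \<Omega> \<Longrightarrow> curl \<Omega> v \<in> L2 \<Omega>"
  and has_weak_curl_curl: "v \<in> H_curl \<Omega> \<Longrightarrow> has_weak_curl \<Omega> v (curl \<Omega> v)"
proof -
  assume "v \<in> H_curl \<Omega>"
  then have "\<exists>w. w \<in> L2 \<Omega> \<and> has_weak_curl \<Omega> v w" by (auto simp: H_curl_def)
  from someI_ex[OF this] show "curl \<Omega> v \<in> L2 \<Omega>" "has_weak_curl \<Omega> v (curl \<Omega> v)"
    by (auto simp: curl_def)
qed

lemma H_curl_L2: "v \<in> H_curl \<Omega> \<Longrightarrow> v \<in> L2 \<Omega>"
  by (simp add: H_curl_def)

lemma H_curlI: "v \<in> L2 \<Omega> \<Longrightarrow> w \<in> L2 \<Omega> \<Longrightarrow> has_weak_curl \<Omega> v w \<Longrightarrow> v \<in> H_curl \<Omega>"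
  by (auto simp: H_curl_def)

text \<open>The choice in the definition of \<^const>\<open>curl\<close> is harmless: every weak curl is almost everywhere the
chosen one.\<close>
lemma curl_AE_eq:
  assumes "open \<Omega>" "bounded \<Omega>" "v \<in> L2 \<Omega>" "w \<in> L2 \<Omega>" "has_weak_curl \<Omega> v w"
  shows "AE x in lebesgue_on \<Omega>. curl \<Omega> v x = w x"
  using weak_curl_unique[OF assms(1,2,3,3) curl_in_L2 assms(4) has_weak_curl_curl assms(5)]
    H_curlI[OF assms(3-5)] by simp

lemma test_function_H_curl:
  assumes "open \<Omega>" "\<phi> \<in> test_functions \<Omega>"
  shows "\<phi> \<in> H_curl \<Omega>"
  using assms
  by (intro H_curlI[OF _ _ has_weak_curl_classical_curl] Cc_L2 Cc_classical_curl Cc_test_function)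

lemma curl_test_function:
  assumes "open \<Omega>" "bounded \<Omega>" "\<phi> \<in> test_functions \<Omega>"
  shows "AE x in lebesgue_on \<Omega>. curl \<Omega> \<phi> x = classical_curl \<phi> x"
  using assms
  by (intro curl_AE_eq Cc_L2 Cc_test_function Cc_classical_curl has_weak_curl_classical_curl)

lemma H_curl_add: "open \<Omega> \<Longrightarrow> v \<in> H_curl \<Omega> \<Longrightarrow> v' \<in> H_curl \<Omega> \<Longrightarrow> (\<lambda>x. v x + v' x) \<in> H_curl \<Omega>"
  by (rule H_curlI[OF L2_add L2_add has_weak_curl_add])
    (assumption | rule H_curl_L2 curl_in_L2 has_weak_curl_curl)+

lemma H_curl_scaleR: "v \<in> H_curl \<Omega> \<Longrightarrow> (\<lambda>x. c *\<^sub>R v x) \<in> H_curl \<Omega>"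
  by (rule H_curlI[OF L2_scaleR L2_scaleR has_weak_curl_scaleR])
    (assumption | rule H_curl_L2 curl_in_L2 has_weak_curl_curl)+

lemma curl_add:
  assumes "open \<Omega>" "bounded \<Omega>" "v \<in> H_curl \<Omega>" "v' \<in> H_curl \<Omega>"
  shows "AE x in lebesgue_on \<Omega>. curl \<Omega> (\<lambda>x. v x + v' x) x = curl \<Omega> v x + curl \<Omega> v' x"
  using assms by (intro curl_AE_eq L2_add has_weak_curl_add H_curl_L2 curl_in_L2 has_weak_curl_curl)

lemma curl_scaleR:
  assumes "open \<Omega>" "bounded \<Omega>" "v \<in> H_curl \<Omega>"
  shows "AE x in lebesgue_on \<Omega>. curl \<Omega> (\<lambda>x. c *\<^sub>R v x) x = c *\<^sub>R curl \<Omega> v x"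
  using assms by (intro curl_AE_eq L2_scaleR has_weak_curl_scaleR H_curl_L2 curl_in_L2 has_weak_curl_curl)

section \<open>The closure of the test fields is a linear space\<close>
lemma H_curl_norm_add:
  assumes "open \<Omega>" "bounded \<Omega>" "v \<in> H_curl \<Omega>" "v' \<in> H_curl \<Omega>"
  shows "H_curl_norm \<Omega> (\<lambda>x. v x + v' x) \<le> H_curl_norm \<Omega> v + H_curl_norm \<Omega> v'"
proof -
  have "L2_norm \<Omega> (curl \<Omega> (\<lambda>x. v x + v' x)) = L2_norm \<Omega> (\<lambda>x. curl \<Omega> v x + curl \<Omega> v' x)"
    using assms by (intro L2_norm_cong_AE curl_add L2_add curl_in_L2 H_curl_add)
  also have "\<dots> \<le> L2_norm \<Omega> (curl \<Omega> v) + L2_norm \<Omega> (curl \<Omega> v')"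
    using assms by (intro L2_norm_triangle curl_in_L2)
  finally have "H_curl_norm \<Omega> (\<lambda>x. v x + v' x)
      \<le> sqrt ((L2_norm \<Omega> v + L2_norm \<Omega> v')\<^sup>2 + (L2_norm \<Omega> (curl \<Omega> v) + L2_norm \<Omega> (curl \<Omega> v'))\<^sup>2)"
    unfolding H_curl_norm_def
    using assms by (intro real_sqrt_le_mono add_mono power_mono L2_norm_triangle H_curl_L2 L2_norm_nonneg)
  also have "\<dots> \<le> H_curl_norm \<Omega> v + H_curl_norm \<Omega> v'"
    unfolding H_curl_norm_def by (rule real_sqrt_sum_squares_triangle_ineq)
  finally show ?thesis .
qed

lemma H_curl_norm_scaleR:
  assumes "open \<Omega>" "bounded \<Omega>" "v \<in> H_curl \<Omega>"
  shows "H_curl_norm \<Omega> (\<lambda>x. c *\<^sub>R v x) = \<bar>c\<bar> * H_curl_norm \<Omega> v"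
proof -
  have "L2_norm \<Omega> (curl \<Omega> (\<lambda>x. c *\<^sub>R v x)) = L2_norm \<Omega> (\<lambda>x. c *\<^sub>R curl \<Omega> v x)"
    using assms by (intro L2_norm_cong_AE curl_scaleR L2_scaleR curl_in_L2 H_curl_scaleR)
  then show ?thesis
    by (simp add: H_curl_norm_def L2_norm_scaleR power_mult_distrib real_sqrt_mult flip: distrib_left)
qed

lemma H_curl_diff_test_function:
  assumes "open \<Omega>" "v \<in> H_curl \<Omega>" "\<phi> \<in> test_functions \<Omega>"
  shows "(\<lambda>x. v x - \<phi> x) \<in> H_curl \<Omega>"
  using H_curl_add[OF assms(1,2) H_curl_scaleR[OF test_function_H_curl[OF assms(1,3)], of "-1"]]
  by simp

lemma H0_curl_add:
  assumes \<Omega>: "open \<Omega>" "bounded \<Omega>" and v: "v \<in> H0_curl \<Omega>" and v': "v' \<in> H0_curl \<Omega>"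
  shows "(\<lambda>x. v x + v' x) \<in> H0_curl \<Omega>"
  unfolding H0_curl_def
proof (intro CollectI conjI allI impI)
  have H: "v \<in> H_curl \<Omega>" "v' \<in> H_curl \<Omega>"
    using v v' by (auto simp: H0_curl_def)
  show "(\<lambda>x. v x + v' x) \<in> H_curl \<Omega>"
    by (intro H_curl_add \<Omega> H)
  fix \<epsilon> :: real assume "\<epsilon> > 0"
  then have "\<epsilon> / 2 > 0" by simp
  then obtain \<phi> \<psi> where \<phi>: "\<phi> \<in> test_functions \<Omega>" "H_curl_norm \<Omega> (\<lambda>x. v x - \<phi> x) < \<epsilon> / 2"
    and \<psi>: "\<psi> \<in> test_functions \<Omega>" "H_curl_norm \<Omega> (\<lambda>x. v' x - \<psi> x) < \<epsilon> / 2"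
    using v v' unfolding H0_curl_def by blast
  note diff = H_curl_diff_test_function[OF \<Omega>(1)]
  have "H_curl_norm \<Omega> (\<lambda>x. (v x - \<phi> x) + (v' x - \<psi> x)) < \<epsilon>"
    using H_curl_norm_add[OF \<Omega> diff[OF H(1) \<phi>(1)] diff[OF H(2) \<psi>(1)]] \<phi>(2) \<psi>(2) by linarith
  then have "H_curl_norm \<Omega> (\<lambda>x. v x + v' x - (\<phi> x + \<psi> x)) < \<epsilon>"
    by (simp add: algebra_simps)
  then show "\<exists>\<phi>\<in>test_functions \<Omega>. H_curl_norm \<Omega> (\<lambda>x. v x + v' x - \<phi> x) < \<epsilon>"
    using test_functions_add[OF \<phi>(1) \<psi>(1)] by (rule bexI[where x = "\<lambda>x. \<phi> x + \<psi> x"])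
qed

lemma H0_curl_scaleR:
  assumes \<Omega>: "open \<Omega>" "bounded \<Omega>" and v: "v \<in> H0_curl \<Omega>"
  shows "(\<lambda>x. c *\<^sub>R v x) \<in> H0_curl \<Omega>"
  unfolding H0_curl_def
proof (intro CollectI conjI allI impI)
  have H: "v \<in> H_curl \<Omega>"
    using v by (auto simp: H0_curl_def)
  show "(\<lambda>x. c *\<^sub>R v x) \<in> H_curl \<Omega>"
    by (rule H_curl_scaleR[OF H])
  fix \<epsilon> :: real assume "\<epsilon> > 0"
  then have "\<epsilon> / (\<bar>c\<bar> + 1) > 0" by (simp add: add_nonneg_pos)
  then obtain \<phi> where \<phi>: "\<phi> \<in> test_functions \<Omega>" "H_curl_norm \<Omega> (\<lambda>x. v x - \<phi> x) < \<epsilon> / (\<bar>c\<bar> + 1)"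
    using v unfolding H0_curl_def by blast
  have "H_curl_norm \<Omega> (\<lambda>x. c *\<^sub>R (v x - \<phi> x)) = \<bar>c\<bar> * H_curl_norm \<Omega> (\<lambda>x. v x - \<phi> x)"
    by (rule H_curl_norm_scaleR[OF \<Omega> H_curl_diff_test_function[OF \<Omega>(1) H \<phi>(1)]])
  also have "\<dots> \<le> (\<bar>c\<bar> + 1) * H_curl_norm \<Omega> (\<lambda>x. v x - \<phi> x)"
    by (intro mult_right_mono) (auto simp: H_curl_norm_def)
  also have "\<dots> < \<epsilon>"
    using \<phi>(2) by (simp add: field_simps add_nonneg_pos)
  finally have "H_curl_norm \<Omega> (\<lambda>x. c *\<^sub>R v x - c *\<^sub>R \<phi> x) < \<epsilon>"
    by (simp add: scaleR_diff_right)
  moreover have "(\<lambda>x. c *\<^sub>R \<phi> x) \<in> test_functions \<Omega>"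
    by (rule test_functions_linear_image[OF \<phi>(1) bounded_linear_scaleR_right])
  ultimately show "\<exists>\<phi>\<in>test_functions \<Omega>. H_curl_norm \<Omega> (\<lambda>x. c *\<^sub>R v x - \<phi> x) < \<epsilon>"
    by (rule bexI[where x = "\<lambda>x. c *\<^sub>R \<phi> x"])
qed

lemma H0_curl_zero:
  assumes \<Omega>: "open \<Omega>" "bounded \<Omega>"
  shows "(\<lambda>x. 0) \<in> H0_curl \<Omega>"
  unfolding H0_curl_def
proof (intro CollectI conjI allI impI)
  show H: "(\<lambda>x. 0) \<in> H_curl \<Omega>"
    by (rule test_function_H_curl[OF \<Omega>(1) test_functions_zero])
  fix \<epsilon> :: real assume "\<epsilon> > 0"
  then have "H_curl_norm \<Omega> (\<lambda>x. 0 - 0) < \<epsilon>"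
    using H_curl_norm_scaleR[OF \<Omega> H, of 0] by simp
  then show "\<exists>\<phi>\<in>test_functions \<Omega>. H_curl_norm \<Omega> (\<lambda>x. 0 - \<phi> x) < \<epsilon>"
    using test_functions_zero by (rule bexI[where x = "\<lambda>x. 0"])
qed

section \<open>Tensor fields and graph norms\<close>
lemma H0_Curl_imp_H_Curl: "P \<in> H0_Curl \<Omega> \<Longrightarrow> P \<in> H_Curl \<Omega>"
  by (simp add: H0_Curl_def H_Curl_def H0_curl_def)

lemma H_Curl_L2:
  assumes "P \<in> H_Curl \<Omega>"
  shows "P \<in> L2 \<Omega>"
  by (rule L2_vec) (use assms H_curl_L2 in \<open>auto simp: H_Curl_def row_eq_nth\<close>)

lemma Curl_nth: "Curl \<Omega> P x $ n = curl \<Omega> (\<lambda>y. row n (P y)) x"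
  by (simp add: Curl_def)

lemma Curl_L2:
  assumes "P \<in> H_Curl \<Omega>"
  shows "Curl \<Omega> P \<in> L2 \<Omega>"
proof (rule L2_vec)
  fix n
  show "(\<lambda>x. Curl \<Omega> P x $ n) \<in> L2 \<Omega>"
    unfolding Curl_nth using assms by (intro curl_in_L2) (simp add: H_Curl_def)
qed

lemma AE_vec_eqI:
  fixes f g :: "'a \<Rightarrow> 'b^'i::finite"
  assumes "\<And>i. AE x in M. f x $ i = g x $ i"
  shows "AE x in M. f x = g x"
proof -
  have "AE x in M. \<forall>i\<in>UNIV. f x $ i = g x $ i"
    by (intro AE_finite_allI finite assms)
  then show ?thesis by eventually_elim (simp add: vec_eq_iff)
qed

lemma row_add: "row n (A + B) = row n A + row n B"
  and row_scaleR: "row n (c *\<^sub>R A) = c *\<^sub>R row n A"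
  for A B :: "real^'n^'m"
  by (simp_all add: row_eq_nth)

lemma H_Curl_add: "open \<Omega> \<Longrightarrow> P \<in> H_Curl \<Omega> \<Longrightarrow> Q \<in> H_Curl \<Omega> \<Longrightarrow> (\<lambda>x. P x + Q x) \<in> H_Curl \<Omega>"
  by (simp add: H_Curl_def row_add H_curl_add)

lemma H_Curl_scaleR: "P \<in> H_Curl \<Omega> \<Longrightarrow> (\<lambda>x. c *\<^sub>R P x) \<in> H_Curl \<Omega>"
  by (simp add: H_Curl_def row_scaleR H_curl_scaleR)

lemma H0_Curl_add: "open \<Omega> \<Longrightarrow> bounded \<Omega> \<Longrightarrow> P \<in> H0_Curl \<Omega> \<Longrightarrow> Q \<in> H0_Curl \<Omega> \<Longrightarrow> (\<lambda>x. P x + Q x) \<in> H0_Curl \<Omega>"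
  by (simp add: H0_Curl_def row_add H0_curl_add)

lemma H0_Curl_scaleR: "open \<Omega> \<Longrightarrow> bounded \<Omega> \<Longrightarrow> P \<in> H0_Curl \<Omega> \<Longrightarrow> (\<lambda>x. c *\<^sub>R P x) \<in> H0_Curl \<Omega>"
  by (simp add: H0_Curl_def row_scaleR H0_curl_scaleR)

lemma H0_Curl_zero: "open \<Omega> \<Longrightarrow> bounded \<Omega> \<Longrightarrow> (\<lambda>x. 0) \<in> H0_Curl \<Omega>"
  by (simp add: H0_Curl_def row_eq_nth H0_curl_zero)

lemma Curl_add:
  assumes "open \<Omega>" "bounded \<Omega>" "P \<in> H_Curl \<Omega>" "Q \<in> H_Curl \<Omega>"
  shows "AE x in lebesgue_on \<Omega>. Curl \<Omega> (\<lambda>x. P x + Q x) x = Curl \<Omega> P x + Curl \<Omega> Q x"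
  by (rule AE_vec_eqI) (use assms in \<open>simp add: Curl_nth row_add H_Curl_def curl_add\<close>)

lemma Curl_scaleR:
  assumes "open \<Omega>" "bounded \<Omega>" "P \<in> H_Curl \<Omega>"
  shows "AE x in lebesgue_on \<Omega>. Curl \<Omega> (\<lambda>x. c *\<^sub>R P x) x = c *\<^sub>R Curl \<Omega> P x"
  by (rule AE_vec_eqI) (use assms in \<open>simp add: Curl_nth row_scaleR H_Curl_def curl_scaleR\<close>)

lemma L2_norm_Curl_add:
  assumes "open \<Omega>" "bounded \<Omega>" "P \<in> H_Curl \<Omega>" "Q \<in> H_Curl \<Omega>"
  shows "L2_norm \<Omega> (Curl \<Omega> (\<lambda>x. P x + Q x)) \<le> L2_norm \<Omega> (Curl \<Omega> P) + L2_norm \<Omega> (Curl \<Omega> Q)"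
proof -
  have "L2_norm \<Omega> (Curl \<Omega> (\<lambda>x. P x + Q x)) = L2_norm \<Omega> (\<lambda>x. Curl \<Omega> P x + Curl \<Omega> Q x)"
    using assms by (intro L2_norm_cong_AE Curl_add L2_add Curl_L2 H_Curl_add)
  also have "\<dots> \<le> L2_norm \<Omega> (Curl \<Omega> P) + L2_norm \<Omega> (Curl \<Omega> Q)"
    using assms by (intro L2_norm_triangle Curl_L2)
  finally show ?thesis .
qed

lemma L2_norm_Curl_scaleR:
  assumes "open \<Omega>" "bounded \<Omega>" "P \<in> H_Curl \<Omega>"
  shows "L2_norm \<Omega> (Curl \<Omega> (\<lambda>x. c *\<^sub>R P x)) = \<bar>c\<bar> * L2_norm \<Omega> (Curl \<Omega> P)"
proof -
  have "L2_norm \<Omega> (Curl \<Omega> (\<lambda>x. c *\<^sub>R P x)) = L2_norm \<Omega> (\<lambda>x. c *\<^sub>R Curl \<Omega> P x)"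
    using assms by (intro L2_norm_cong_AE Curl_scaleR L2_scaleR Curl_L2 H_Curl_scaleR)
  then show ?thesis by (simp add: L2_norm_scaleR)
qed

lemma L2_norm_linear_add:
  fixes f g :: "'a::euclidean_space \<Rightarrow> 'b::euclidean_space" and T :: "'b \<Rightarrow> 'c::euclidean_space"
  assumes "f \<in> L2 \<Omega>" "g \<in> L2 \<Omega>" and T: "linear T"
  shows "L2_norm \<Omega> (\<lambda>x. T (f x + g x)) \<le> L2_norm \<Omega> (\<lambda>x. T (f x)) + L2_norm \<Omega> (\<lambda>x. T (g x))"
  unfolding linear_add[OF T] by (intro L2_norm_triangle L2_linear_image[OF _ T] assms)

text \<open>Covers both norms of the main result: \<open>T\<close> is the identity for one and the symmetric part for the
other.  Definiteness is an assumption because it holds for different reasons in the two cases.\<close>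
lemma norm_modulo_AE_graph_norm:
  fixes \<Omega> :: "(('n::{finite,linorder}) rvec) set" and T :: "'n rmat \<Rightarrow> 'n rmat"
  assumes \<Omega>: "open \<Omega>" "bounded \<Omega>" and T: "linear T"
    and p: "p = (\<lambda>P. sqrt ((L2_norm \<Omega> (\<lambda>x. T (P x)))\<^sup>2 + (L2_norm \<Omega> (Curl \<Omega> P))\<^sup>2))"
    and definite: "\<And>P. P \<in> H0_Curl \<Omega> \<Longrightarrow> p P = 0 \<longleftrightarrow> (AE x in lebesgue_on \<Omega>. P x = 0)"
  shows "norm_modulo_AE (lebesgue_on \<Omega>) (H0_Curl \<Omega>) p"
  unfolding norm_modulo_AE_def
proof (intro conjI ballI allI)
  show "(\<lambda>x. 0) \<in> H0_Curl \<Omega>" by (rule H0_Curl_zero[OF \<Omega>])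
next
  fix P assume P0: "P \<in> H0_Curl \<Omega>"
  then have P: "P \<in> H_Curl \<Omega>" by (rule H0_Curl_imp_H_Curl)
  show "0 \<le> p P" by (simp add: p)
  show "p P = 0 \<longleftrightarrow> (AE x in lebesgue_on \<Omega>. P x = 0)" by (rule definite[OF P0])
  show "(\<lambda>x. c *\<^sub>R P x) \<in> H0_Curl \<Omega>" for c by (rule H0_Curl_scaleR[OF \<Omega> P0])
  show "p (\<lambda>x. c *\<^sub>R P x) = \<bar>c\<bar> * p P" for c
    unfolding p linear_scale[OF T] L2_norm_scaleR L2_norm_Curl_scaleR[OF \<Omega> P]
    by (simp add: power_mult_distrib real_sqrt_mult flip: distrib_left)
  fix Q assume Q0: "Q \<in> H0_Curl \<Omega>"
  then have Q: "Q \<in> H_Curl \<Omega>" by (rule H0_Curl_imp_H_Curl)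
  show "(\<lambda>x. P x + Q x) \<in> H0_Curl \<Omega>" by (rule H0_Curl_add[OF \<Omega> P0 Q0])
  have "p (\<lambda>x. P x + Q x)
      \<le> sqrt ((L2_norm \<Omega> (\<lambda>x. T (P x)) + L2_norm \<Omega> (\<lambda>x. T (Q x)))\<^sup>2
        + (L2_norm \<Omega> (Curl \<Omega> P) + L2_norm \<Omega> (Curl \<Omega> Q))\<^sup>2)"
    unfolding p
    by (intro real_sqrt_le_mono add_mono power_mono L2_norm_linear_add L2_norm_Curl_add
        H_Curl_L2 P Q T \<Omega> L2_norm_nonneg)
  also have "\<dots> \<le> p P + p Q"
    unfolding p by (rule real_sqrt_sum_squares_triangle_ineq)
  finally show "p (\<lambda>x. P x + Q x) \<le> p P + p Q" .
qed

section \<open>Passing to the closure\<close>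
lemma L2_norm_vec_le:
  fixes f :: "'a::euclidean_space \<Rightarrow> 'b::euclidean_space^'i::finite"
  assumes "f \<in> L2 \<Omega>" "\<And>i. L2_norm \<Omega> (\<lambda>x. f x $ i) \<le> \<epsilon>"
  shows "L2_norm \<Omega> f \<le> real CARD('i) * \<epsilon>"
proof -
  have "L2_norm \<Omega> f = L2_set (\<lambda>i. L2_norm \<Omega> (\<lambda>x. f x $ i)) UNIV"
    unfolding L2_set_def L2_norm_vec[OF assms(1), symmetric]
    by (rule real_sqrt_unique[symmetric]) (rule refl, rule L2_norm_nonneg)
  also have "\<dots> \<le> (\<Sum>i\<in>UNIV. L2_norm \<Omega> (\<lambda>x. f x $ i))"
    by (rule L2_set_le_sum) (rule L2_norm_nonneg)
  also have "\<dots> \<le> of_nat CARD('i) * \<epsilon>"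
    by (rule sum_bounded_above) (rule assms(2))
  finally show ?thesis .
qed

text \<open>The rows are approximated separately, each up to \<open>\<epsilon> / N\<close>.\<close>
lemma H0_Curl_approximation:
  fixes \<Omega> :: "(('n::{finite,linorder}) rvec) set"
  assumes \<Omega>: "open \<Omega>" "bounded \<Omega>" and P: "P \<in> H0_Curl \<Omega>" and "0 < \<epsilon>"
  obtains \<Phi> where "\<And>n. (\<lambda>x. row n (\<Phi> x)) \<in> test_functions \<Omega>" "(\<lambda>x. P x - \<Phi> x) \<in> H_Curl \<Omega>"
    "L2_norm \<Omega> (\<lambda>x. P x - \<Phi> x) \<le> \<epsilon>" "L2_norm \<Omega> (Curl \<Omega> (\<lambda>x. P x - \<Phi> x)) \<le> \<epsilon>"
proof -
  define \<delta> where "\<delta> = \<epsilon> / CARD('n)"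
  have \<delta>: "0 < \<delta>" "CARD('n) * \<delta> = \<epsilon>"
    using \<open>0 < \<epsilon>\<close> by (auto simp: \<delta>_def)
  have "\<forall>n. \<exists>\<phi>. \<phi> \<in> test_functions \<Omega> \<and> H_curl_norm \<Omega> (\<lambda>x. row n (P x) - \<phi> x) < \<delta>"
    using P \<delta>(1) unfolding H0_Curl_def H0_curl_def by blast
  from choice[OF this] obtain \<phi> where \<phi>: "\<And>n. \<phi> n \<in> test_functions \<Omega>"
    "\<And>n. H_curl_norm \<Omega> (\<lambda>x. row n (P x) - \<phi> n x) < \<delta>"
    by auto
  define \<Phi> where "\<Phi> x = (\<chi> n. \<phi> n x)" for x
  have row\<Phi>: "row n (\<Phi> x) = \<phi> n x" for n x
    by (simp add: \<Phi>_def row_eq_nth)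
  have row_diff: "row n (P x - \<Phi> x) = row n (P x) - \<phi> n x" for n x
    by (simp add: \<Phi>_def row_eq_nth)
  have R: "(\<lambda>x. P x - \<Phi> x) \<in> H_Curl \<Omega>"
    using P \<phi>(1) H_curl_diff_test_function[OF \<Omega>(1)]
    by (simp add: H_Curl_def H0_Curl_def H0_curl_def row_diff)
  have small: "L2_norm \<Omega> (\<lambda>x. row n (P x - \<Phi> x)) \<le> \<delta>"
    "L2_norm \<Omega> (curl \<Omega> (\<lambda>x. row n (P x - \<Phi> x))) \<le> \<delta>" for n
    using \<phi>(2)[of n] unfolding row_diff H_curl_norm_def
    by (auto intro: order_trans[OF real_sqrt_sum_squares_ge1 less_imp_le]
        order_trans[OF real_sqrt_sum_squares_ge2 less_imp_le])
  show thesis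
  proof (rule that[OF _ R])
    show "(\<lambda>x. row n (\<Phi> x)) \<in> test_functions \<Omega>" for n
      by (simp add: row\<Phi> \<phi>(1))
    show "L2_norm \<Omega> (\<lambda>x. P x - \<Phi> x) \<le> \<epsilon>"
      unfolding \<delta>(2)[symmetric]
      by (rule L2_norm_vec_le[OF H_Curl_L2[OF R]]) (use small(1) in \<open>simp add: row_eq_nth\<close>)
    show "L2_norm \<Omega> (Curl \<Omega> (\<lambda>x. P x - \<Phi> x)) \<le> \<epsilon>"
      unfolding \<delta>(2)[symmetric]
      by (rule L2_norm_vec_le[OF Curl_L2[OF R]]) (simp add: Curl_nth small(2))
  qed
qed

text \<open>Both sides of the estimate for test fields are continuous in the graph norm.\<close>
theorem Korn_Curl_inequality:
  fixes \<Omega> :: "(('n::{finite,linorder}) rvec) set"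
  assumes \<Omega>: "open \<Omega>" "bounded \<Omega>"
  obtains C where "0 \<le> C"
    and "\<And>P. P \<in> H0_Curl \<Omega> \<Longrightarrow>
      L2_norm \<Omega> P \<le> C * (L2_norm \<Omega> (\<lambda>x. sym_part (P x)) + L2_norm \<Omega> (Curl \<Omega> P))"
proof -
  obtain C where C: "0 \<le> C"
    and test: "\<And>\<Phi>. (\<And>n. (\<lambda>x. row n (\<Phi> x)) \<in> test_functions \<Omega>) \<Longrightarrow>
      L2_norm \<Omega> \<Phi> \<le> C * (L2_norm \<Omega> (\<lambda>x. sym_part (\<Phi> x)) + L2_norm \<Omega> (classical_Curl \<Phi>))"
    by (rule Korn_Curl_test_fields[OF \<Omega>]) blast
  show thesis
  proof (rule that[OF C])
    fix P assume P0: "P \<in> H0_Curl \<Omega>"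
    then have P: "P \<in> H_Curl \<Omega>" by (rule H0_Curl_imp_H_Curl)
    show "L2_norm \<Omega> P \<le> C * (L2_norm \<Omega> (\<lambda>x. sym_part (P x)) + L2_norm \<Omega> (Curl \<Omega> P))"
    proof (rule field_le_epsilon)
      fix \<delta> :: real assume "0 < \<delta>"
      \<comment> \<open>An approximation error \<open>\<epsilon>\<close> enters once on the left and twice, with factor \<open>C\<close>, on the right.\<close>
      define \<epsilon> where "\<epsilon> = \<delta> / (1 + 2 * C)"
      have "(1 + 2 * C) * \<epsilon> = \<delta>"
        using C by (simp add: \<epsilon>_def)
      moreover have "\<epsilon> + C * (2 * \<epsilon>) = (1 + 2 * C) * \<epsilon>"
        by (simp add: algebra_simps)
      ultimately have \<epsilon>: "0 < \<epsilon>" "\<epsilon> + C * (2 * \<epsilon>) = \<delta>"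
        using \<open>0 < \<delta>\<close> C by (simp add: \<epsilon>_def, simp only:)
      obtain \<Phi> where \<Phi>: "\<And>n. (\<lambda>x. row n (\<Phi> x)) \<in> test_functions \<Omega>"
        and R: "(\<lambda>x. P x - \<Phi> x) \<in> H_Curl \<Omega>"
        and small: "L2_norm \<Omega> (\<lambda>x. P x - \<Phi> x) \<le> \<epsilon>" "L2_norm \<Omega> (Curl \<Omega> (\<lambda>x. P x - \<Phi> x)) \<le> \<epsilon>"
        by (rule H0_Curl_approximation[OF \<Omega> P0 \<epsilon>(1)]) blast
      let ?R = "\<lambda>x. (-1) *\<^sub>R (P x - \<Phi> x)"
      have mR: "?R \<in> H_Curl \<Omega>" by (rule H_Curl_scaleR[OF R])
      have \<Phi>_eq: "P x + ?R x = \<Phi> x" for x by simp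
      have \<Phi>H: "\<Phi> \<in> H_Curl \<Omega>"
        using test_function_H_curl[OF \<Omega>(1) \<Phi>] by (simp add: H_Curl_def)
      have "L2_norm \<Omega> (classical_Curl \<Phi>) = L2_norm \<Omega> (Curl \<Omega> \<Phi>)"
      proof (rule L2_norm_cong_AE)
        show "classical_Curl \<Phi> \<in> L2 \<Omega>"
          unfolding classical_Curl_def[abs_def]
          by (rule L2_vec) (simp add: Cc_L2[OF Cc_classical_curl[OF \<Phi>] \<Omega>(1)])
        show "AE x in lebesgue_on \<Omega>. classical_Curl \<Phi> x = Curl \<Omega> \<Phi> x"
        proof (rule AE_vec_eqI)
          show "AE x in lebesgue_on \<Omega>. classical_Curl \<Phi> x $ n = Curl \<Omega> \<Phi> x $ n" for n
            using curl_test_function[OF \<Omega> \<Phi>, of n]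
            by eventually_elim (simp add: classical_Curl_def Curl_nth)
        qed
      qed (rule Curl_L2[OF \<Phi>H])
      also have "\<dots> \<le> L2_norm \<Omega> (Curl \<Omega> P) + L2_norm \<Omega> (Curl \<Omega> ?R)"
        using L2_norm_Curl_add[OF \<Omega> P mR] unfolding \<Phi>_eq .
      also have "L2_norm \<Omega> (Curl \<Omega> ?R) = L2_norm \<Omega> (Curl \<Omega> (\<lambda>x. P x - \<Phi> x))"
        unfolding L2_norm_Curl_scaleR[OF \<Omega> R] by simp
      finally have curl_le: "L2_norm \<Omega> (classical_Curl \<Phi>) \<le> L2_norm \<Omega> (Curl \<Omega> P) + \<epsilon>"
        using small(2) by linarith
      have "L2_norm \<Omega> (\<lambda>x. sym_part (\<Phi> x))
          \<le> L2_norm \<Omega> (\<lambda>x. sym_part (P x)) + L2_norm \<Omega> (\<lambda>x. sym_part (?R x))"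
        using L2_norm_linear_add[OF H_Curl_L2[OF P] H_Curl_L2[OF mR] linear_sym_part] unfolding \<Phi>_eq .
      also have "L2_norm \<Omega> (\<lambda>x. sym_part (?R x)) \<le> 1 * L2_norm \<Omega> (\<lambda>x. P x - \<Phi> x)"
      proof (rule L2_norm_mono[OF L2_linear_image[OF H_Curl_L2[OF mR] linear_sym_part] H_Curl_L2[OF R]])
        show "norm (sym_part (?R x)) \<le> 1 * norm (P x - \<Phi> x)" for x
          using norm_sym_part_le[of "?R x"] by (simp only: norm_scaleR)
      qed simp
      finally have sym_le: "L2_norm \<Omega> (\<lambda>x. sym_part (\<Phi> x)) \<le> L2_norm \<Omega> (\<lambda>x. sym_part (P x)) + \<epsilon>"
        using small(1) by linarith
      have "L2_norm \<Omega> P \<le> L2_norm \<Omega> \<Phi> + L2_norm \<Omega> (\<lambda>x. P x - \<Phi> x)"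
        using L2_norm_triangle[OF H_Curl_L2[OF \<Phi>H] H_Curl_L2[OF R]] by simp
      also have "L2_norm \<Omega> \<Phi> \<le> C * ((L2_norm \<Omega> (\<lambda>x. sym_part (P x)) + \<epsilon>) + (L2_norm \<Omega> (Curl \<Omega> P) + \<epsilon>))"
        by (rule order_trans[OF test[OF \<Phi>] mult_left_mono[OF add_mono[OF sym_le curl_le] C]])
      finally have "L2_norm \<Omega> P \<le> C * (L2_norm \<Omega> (\<lambda>x. sym_part (P x)) + L2_norm \<Omega> (Curl \<Omega> P))
          + (\<epsilon> + C * (2 * \<epsilon>))"
        using small(1) by (simp add: algebra_simps)
      then show "L2_norm \<Omega> P \<le> C * (L2_norm \<Omega> (\<lambda>x. sym_part (P x)) + L2_norm \<Omega> (Curl \<Omega> P)) + \<delta>"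
        unfolding \<epsilon>(2) .
    qed
  qed
qed

theorem theorem13:
  fixes \<Omega> :: "(real^'n::{finite,linorder}) set"
  assumes "open \<Omega>" and "connected \<Omega>" and "\<Omega> \<noteq> {}" and "bounded \<Omega>"
    and "lipschitz_boundary \<Omega>" and "connected (frontier \<Omega>)"
  shows "norm_modulo_AE (lebesgue_on \<Omega>) (H0_Curl \<Omega>) (H_Curl_norm \<Omega>) \<and>
         norm_modulo_AE (lebesgue_on \<Omega>) (H0_Curl \<Omega>) (sym_Curl_norm \<Omega>) \<and>
         equivalent_on (H0_Curl \<Omega>) (H_Curl_norm \<Omega>) (sym_Curl_norm \<Omega>) \<and>
         (\<exists>c>0. \<forall>P\<in>H0_Curl \<Omega>.
            c * (H_Curl_norm \<Omega> P)\<^sup>2 \<le> (sym_Curl_norm \<Omega> P)\<^sup>2 \<and>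
            (sym_Curl_norm \<Omega> P)\<^sup>2 =
              (L2_norm \<Omega> (\<lambda>x. sym_part (P x)))\<^sup>2 + (L2_norm \<Omega> (Curl \<Omega> P))\<^sup>2)"
proof -
  note \<Omega> = \<open>open \<Omega>\<close> \<open>bounded \<Omega>\<close>
  obtain C where C: "0 \<le> C"
    and Korn: "\<And>P. P \<in> H0_Curl \<Omega> \<Longrightarrow>
      L2_norm \<Omega> P \<le> C * (L2_norm \<Omega> (\<lambda>x. sym_part (P x)) + L2_norm \<Omega> (Curl \<Omega> P))"
    by (rule Korn_Curl_inequality[OF \<Omega>]) blast
  \<comment> \<open>\<open>\<parallel>P\<parallel>\<^sup>2 + \<parallel>Curl P\<parallel>\<^sup>2 \<le> 2 C\<^sup>2 (\<parallel>sym P\<parallel>\<^sup>2 + \<parallel>Curl P\<parallel>\<^sup>2) + \<parallel>Curl P\<parallel>\<^sup>2\<close>\<close>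
  define c where "c = 1 / (2 * C\<^sup>2 + 1)"
  have pos: "0 < 2 * C\<^sup>2 + 1"
    using zero_le_power2[of C] by linarith
  then have c: "0 < c" by (simp add: c_def)
  have H_sq: "(H_Curl_norm \<Omega> P)\<^sup>2 = (L2_norm \<Omega> P)\<^sup>2 + (L2_norm \<Omega> (Curl \<Omega> P))\<^sup>2"
    and sym_sq: "(sym_Curl_norm \<Omega> P)\<^sup>2
      = (L2_norm \<Omega> (\<lambda>x. sym_part (P x)))\<^sup>2 + (L2_norm \<Omega> (Curl \<Omega> P))\<^sup>2" for P
    by (auto simp: H_Curl_norm_def sym_Curl_norm_def)
  have nonneg: "0 \<le> H_Curl_norm \<Omega> P" "0 \<le> sym_Curl_norm \<Omega> P" for P
    by (auto simp: H_Curl_norm_def sym_Curl_norm_def)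
  have lower_sq: "c * (H_Curl_norm \<Omega> P)\<^sup>2 \<le> (sym_Curl_norm \<Omega> P)\<^sup>2" if P: "P \<in> H0_Curl \<Omega>" for P
  proof -
    let ?s = "L2_norm \<Omega> (\<lambda>x. sym_part (P x))" and ?r = "L2_norm \<Omega> (Curl \<Omega> P)"
    have "(L2_norm \<Omega> P)\<^sup>2 \<le> (C * (?s + ?r))\<^sup>2"
      by (intro power_mono Korn P L2_norm_nonneg)
    also have "\<dots> \<le> C\<^sup>2 * (2 * (?s\<^sup>2 + ?r\<^sup>2))"
      unfolding power_mult_distrib using sum_squares_bound[of ?s ?r]
      by (intro mult_left_mono) (auto simp: power2_sum)
    finally have "(H_Curl_norm \<Omega> P)\<^sup>2 \<le> (2 * C\<^sup>2 + 1) * (sym_Curl_norm \<Omega> P)\<^sup>2"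
      unfolding H_sq sym_sq by (simp add: algebra_simps add_increasing)
    then show ?thesis
      using pos by (simp add: c_def field_simps)
  qed
  have lower: "sqrt c * H_Curl_norm \<Omega> P \<le> sym_Curl_norm \<Omega> P" if "P \<in> H0_Curl \<Omega>" for P
    by (rule power2_le_imp_le) (use lower_sq[OF that] c nonneg in \<open>auto simp: power_mult_distrib\<close>)
  have upper: "sym_Curl_norm \<Omega> P \<le> H_Curl_norm \<Omega> P" if "P \<in> H0_Curl \<Omega>" for P
  proof -
    have P: "P \<in> L2 \<Omega>" by (rule H_Curl_L2[OF H0_Curl_imp_H_Curl[OF that]])
    have "L2_norm \<Omega> (\<lambda>x. sym_part (P x)) \<le> 1 * L2_norm \<Omega> P"
      by (rule L2_norm_mono[OF L2_linear_image[OF P linear_sym_part] P]) (auto simp: norm_sym_part_le)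
    then show ?thesis
      unfolding sym_Curl_norm_def H_Curl_norm_def
      by (intro real_sqrt_le_mono add_right_mono power_mono) (auto simp: L2_norm_nonneg)
  qed
  have H_definite: "H_Curl_norm \<Omega> P = 0 \<longleftrightarrow> (AE x in lebesgue_on \<Omega>. P x = 0)" if P0: "P \<in> H0_Curl \<Omega>" for P
  proof -
    have P: "P \<in> H_Curl \<Omega>" by (rule H0_Curl_imp_H_Curl[OF P0])
    have "L2_norm \<Omega> (Curl \<Omega> P) = 0" if ae: "AE x in lebesgue_on \<Omega>. P x = 0"
      unfolding L2_norm_eq_0_iff[OF Curl_L2[OF P]]
    proof (rule AE_vec_eqI)
      fix n
      have row: "(\<lambda>x. row n (P x)) \<in> H_curl \<Omega>"
        using P by (simp add: H_Curl_def)
      have zero: "has_weak_curl \<Omega> (\<lambda>x. 0) (\<lambda>x. 0)"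
        using has_weak_curl_scaleR[OF has_weak_curl_curl[OF row], of 0] by simp
      have "AE x in lebesgue_on \<Omega>. row n (P x) = 0"
        using ae by eventually_elim (simp add: row_eq_nth)
      then show "AE x in lebesgue_on \<Omega>. Curl \<Omega> P x $ n = 0 $ n"
        using weak_curl_unique[OF \<Omega> H_curl_L2[OF row] L2_zero curl_in_L2[OF row] L2_zero
            has_weak_curl_curl[OF row] zero]
        by (simp add: Curl_nth)
    qed
    then show ?thesis
      using L2_norm_eq_0_iff[OF H_Curl_L2[OF P]] by (auto simp: H_Curl_norm_def)
  qed
  have sym_definite: "sym_Curl_norm \<Omega> P = 0 \<longleftrightarrow> (AE x in lebesgue_on \<Omega>. P x = 0)"
    if P: "P \<in> H0_Curl \<Omega>" for P
  proof -
    have "H_Curl_norm \<Omega> P = 0" if "sym_Curl_norm \<Omega> P = 0"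
    proof -
      have "sqrt c * H_Curl_norm \<Omega> P \<le> 0"
        using lower[OF P] that by simp
      then show ?thesis
        using c nonneg(1)[of P] by (simp add: mult_le_0_iff)
    qed
    moreover have "sym_Curl_norm \<Omega> P = 0" if "H_Curl_norm \<Omega> P = 0"
      using upper[OF P] nonneg(2)[of P] that by simp
    ultimately have "sym_Curl_norm \<Omega> P = 0 \<longleftrightarrow> H_Curl_norm \<Omega> P = 0"
      by blast
    then show ?thesis using H_definite[OF P] by simp
  qed
  show ?thesis
  proof (intro conjI)
    show "norm_modulo_AE (lebesgue_on \<Omega>) (H0_Curl \<Omega>) (H_Curl_norm \<Omega>)"
      by (rule norm_modulo_AE_graph_norm[OF \<Omega> linear_id _ H_definite]) (auto simp: H_Curl_norm_def fun_eq_iff)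
    show "norm_modulo_AE (lebesgue_on \<Omega>) (H0_Curl \<Omega>) (sym_Curl_norm \<Omega>)"
      by (rule norm_modulo_AE_graph_norm[OF \<Omega> linear_sym_part _ sym_definite]) (auto simp: sym_Curl_norm_def fun_eq_iff)
    show "equivalent_on (H0_Curl \<Omega>) (H_Curl_norm \<Omega>) (sym_Curl_norm \<Omega>)"
      unfolding equivalent_on_def
      using c lower upper by (intro exI[of _ "sqrt c"] conjI exI[of _ 1]) auto
    show "\<exists>c>0. \<forall>P\<in>H0_Curl \<Omega>. c * (H_Curl_norm \<Omega> P)\<^sup>2 \<le> (sym_Curl_norm \<Omega> P)\<^sup>2 \<and>
        (sym_Curl_norm \<Omega> P)\<^sup>2 = (L2_norm \<Omega> (\<lambda>x. sym_part (P x)))\<^sup>2 + (L2_norm \<Omega> (Curl \<Omega> P))\<^sup>2"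
      using c lower_sq sym_sq by blast
  qed
qed

end
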